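(* Let $n\ge 2$, $M=\mathbb{R}^n$, and $N=M\times M$ with coordinates $(x_1,\ldots,x_n,X_1,\ldots,X_n)$. Let $\Phi^1,\ldots,\Phi^{n-1}$ be smooth real-valued functions on $M$, and assume that there exist two constants $\ell_1,\ell_2>0$ such that for all $k=1,\ldots,n-1$ and all $m\in M$, $$0<\ell_1\le\left|\partial_{k,k+1}\Phi^k(m)\right|\le \ell_2 .$$ For $k=1,\dots,n-1$ let $h_k:N\to M$ be $h_k(x_1,\ldots,x_n,X_1,\ldots,X_n)=(x_1,\ldots,x_k,X_{k+1},\ldots,X_n)$ and let $\rho_k$ be the $(n-2)$-form on $M$ $$\rho_k=\Phi^k\,dx_1\wedge\cdots\wedge dx_{k-1}\wedge dx_{k+2}\wedge\cdots\wedge dx_n .$$ Then the $(n-2)$-form $\Lambda=\sum_{k=1}^{n-1}h_k^*\rho_k$ on $N$ is a generating form with respect to the pair $(\alpha,\tilde\alpha)$, where $\alpha=(-1)^{n-1}x_n\,dx_1\wedge\cdots\wedge dx_{n-1}$ and $\tilde\alpha=x_1\,dx_2\wedge\cdots\wedge dx_n$, and the generated map $(X_1,\ldots,X_n)=f(x_1,\ldots,x_n)$ is implicitly given by the $n$ equations $$X_1=\partial_2\Phi^1(x_1,X_2,\ldots,X_n),$$ $$\partial_k\Phi^k(x_1,\ldots,x_k,X_{k+1},\ldots,X_n)=\partial_{k+2}\Phi^{k+1}(x_1,\ldots,x_{k+1},X_{k+2},\ldots,X_n)\quad\text{for }k=1,\ldots,n-2,$$ $$\partial_{n-1}\Phi^{n-1}(x_1,\ldots,x_{n-1},X_n)=x_n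 .$$
   Context: Here $\partial_i\Phi$ denotes the partial derivative of $\Phi:\mathbb{R}^n\to\mathbb{R}$ with respect to its $i$-th argument, and $\partial_{i,j}\Phi=\partial_i\partial_j\Phi$. The volume form on $M=\mathbb{R}^n$ is $\Omega=dx_1\wedge\cdots\wedge dx_n$; both $\alpha$ and $\tilde\alpha$ satisfy $d\alpha=d\tilde\alpha=\Omega$. Let $\pi_1,\pi_2:N=M\times M\to M$ be the projections $\pi_1(m_1,m_2)=m_1$, $\pi_2(m_1,m_2)=m_2$; thus $\pi_1^*\alpha=(-1)^{n-1}x_n\,dx_1\wedge\cdots\wedge dx_{n-1}$ and $\pi_2^*\tilde\alpha=X_1\,dX_2\wedge\cdots\wedge dX_n$. Definition. An $(n-2)$-form $\Lambda$ on $N$ is a generating form with respect to $(\alpha,\tilde\alpha)$ if the set of points of $N$ at which the $(n-1)$-form $\Gamma=\pi_2^*\tilde\alpha-\pi_1^*\alpha-d\Lambda$ vanishes (as a section, i.e. all its coefficients vanish at the point) is the graph $\{(m,f(m)) : m\in M\}$ of a smooth function $f:M\to M$. In that case $f$ is said to be generated by $\Lambda$. *)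

theory Defs
  imports "HOL-Analysis.Analysis"
begin

primrec C_times_diff :: "nat \<Rightarrow> ('a::real_normed_vector \<Rightarrow> 'b::real_normed_vector) \<Rightarrow> bool" where
  "C_times_diff 0 f \<longleftrightarrow> continuous_on UNIV f"
| "C_times_diff (Suc k) f \<longleftrightarrow>
     (\<forall>x. f differentiable (at x)) \<and>
     (\<forall>v. C_times_diff k (\<lambda>x. frechet_derivative f (at x) v))"

definition smooth :: "('a::real_normed_vector \<Rightarrow> 'b::real_normed_vector) \<Rightarrow> bool" where
  "smooth f \<longleftrightarrow> (\<forall>k. C_times_diff k f)"


text \<open>A differential k-form is represented by the function sending a point and a list of k tangent
  vectors to a real number; its values on lists of any other length are irrelevant.\<close>

type_synonym 'a form = "'a \<Rightarrow> 'a list \<Rightarrow> real"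

definition alternating_multilinear :: "nat \<Rightarrow> ('a::real_vector list \<Rightarrow> real) \<Rightarrow> bool" where
  "alternating_multilinear k \<phi> \<longleftrightarrow>
     (\<forall>vs i. length vs = k \<and> i < k \<longrightarrow> linear (\<lambda>v. \<phi> (vs[i := v]))) \<and>
     (\<forall>vs i j. length vs = k \<and> i < j \<and> j < k \<and> vs ! i = vs ! j \<longrightarrow> \<phi> vs = 0)"

definition diff_form :: "nat \<Rightarrow> 'a::euclidean_space form \<Rightarrow> bool" where
  "diff_form k \<omega> \<longleftrightarrow>
     (\<forall>p. alternating_multilinear k (\<omega> p)) \<and>
     (\<forall>vs. length vs = k \<longrightarrow> smooth (\<lambda>p. \<omega> p vs))"

text \<open>The wedge product of a list of covectors, in the determinant normalisation
  (no factor 1/k!); the empty product is the constant 1.\<close>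

definition wedge :: "('a \<Rightarrow> real) list \<Rightarrow> 'a list \<Rightarrow> real" where
  "wedge \<theta>s vs =
     (\<Sum>\<pi> | \<pi> permutes {..<length \<theta>s}.
        of_int (sign \<pi>) * (\<Prod>i<length \<theta>s. (\<theta>s ! i) (vs ! \<pi> i)))"

text \<open>The invariant formula for d, evaluated on constant vector fields (so that the Lie bracket terms
  are absent). Normalised so that d of a function times a constant form is the wedge of the
  differential with that form.\<close>

definition ext_deriv :: "'a::real_normed_vector form \<Rightarrow> 'a form" where
  "ext_deriv \<omega> p vs =
     (\<Sum>i<length vs. (-1) ^ i *
        frechet_derivative (\<lambda>q. \<omega> q (take i vs @ drop (Suc i) vs)) (at p) (vs ! i))"

definition pullback ::
    "('a::real_normed_vector \<Rightarrow> 'b::real_normed_vector) \<Rightarrow> 'b form \<Rightarrow> 'a form" where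
  "pullback h \<omega> p vs = \<omega> (h p) (map (frechet_derivative h (at p)) vs)"


definition Gamma_form ::
    "'m::euclidean_space form \<Rightarrow> 'm form \<Rightarrow> ('m \<times> 'm) form \<Rightarrow> ('m \<times> 'm) form" where
  "Gamma_form \<alpha> \<alpha>' \<Lambda> p vs = pullback snd \<alpha>' p vs - pullback fst \<alpha> p vs - ext_deriv \<Lambda> p vs"

definition vanishing_set :: "nat \<Rightarrow> 'a form \<Rightarrow> 'a set" where
  "vanishing_set k \<omega> = {p. \<forall>vs. length vs = k \<longrightarrow> \<omega> p vs = 0}"

definition generates ::
    "'m::euclidean_space form \<Rightarrow> 'm form \<Rightarrow> ('m \<times> 'm) form \<Rightarrow> ('m \<Rightarrow> 'm) \<Rightarrow> bool" where
  "generates \<alpha> \<alpha>' \<Lambda> f \<longleftrightarrow>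
     smooth f \<and>
     vanishing_set (DIM('m) - 1) (Gamma_form \<alpha> \<alpha>' \<Lambda>) = {(m, f m) | m. m \<in> UNIV}"

definition generating_form ::
    "'m::euclidean_space form \<Rightarrow> 'm form \<Rightarrow> ('m \<times> 'm) form \<Rightarrow> bool" where
  "generating_form \<alpha> \<alpha>' \<Lambda> \<longleftrightarrow>
     diff_form (DIM('m) - 2) \<Lambda> \<and> (\<exists>f. generates \<alpha> \<alpha>' \<Lambda> f)"


text \<open>The coordinates of \<open>real ^ 'n\<close> are numbered by \<open>e\<close>, intended to be a bijection from
  \<open>{1..CARD('n)}\<close> onto the index type: the i-th coordinate of \<open>x\<close> is \<open>x $ e i\<close>.\<close>

definition part_deriv ::
    "(nat \<Rightarrow> 'n::finite) \<Rightarrow> nat \<Rightarrow> (real ^ 'n \<Rightarrow> real) \<Rightarrow> real ^ 'n \<Rightarrow> real" where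
  "part_deriv e i \<Phi> m = deriv (\<lambda>t. \<Phi> (m + t *\<^sub>R axis (e i) 1)) 0"

definition dx_wedge :: "(nat \<Rightarrow> 'n::finite) \<Rightarrow> nat list \<Rightarrow> (real ^ 'n) list \<Rightarrow> real" where
  "dx_wedge e is = wedge (map (\<lambda>i v. v $ e i) is)"

definition alpha :: "(nat \<Rightarrow> 'n::finite) \<Rightarrow> (real ^ 'n) form" where
  "alpha e x vs = (-1) ^ (CARD('n) - 1) * x $ e CARD('n) * dx_wedge e [1..<CARD('n)] vs"

definition alpha_tilde :: "(nat \<Rightarrow> 'n::finite) \<Rightarrow> (real ^ 'n) form" where
  "alpha_tilde e x vs = x $ e 1 * dx_wedge e [2..<CARD('n) + 1] vs"

definition h_map :: "(nat \<Rightarrow> 'n::finite) \<Rightarrow> nat \<Rightarrow> (real ^ 'n) \<times> (real ^ 'n) \<Rightarrow> real ^ 'n" where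
  "h_map e k p = (\<chi> i. if i \<in> e ` {1..k} then fst p $ i else snd p $ i)"

definition rho :: "(nat \<Rightarrow> 'n::finite) \<Rightarrow> (nat \<Rightarrow> real ^ 'n \<Rightarrow> real) \<Rightarrow> nat \<Rightarrow> (real ^ 'n) form" where
  "rho e \<Phi> k x vs = \<Phi> k x * dx_wedge e ([1..<k] @ [k + 2..<CARD('n) + 1]) vs"

definition Lambda ::
    "(nat \<Rightarrow> 'n::finite) \<Rightarrow> (nat \<Rightarrow> real ^ 'n \<Rightarrow> real) \<Rightarrow> ((real ^ 'n) \<times> (real ^ 'n)) form" where
  "Lambda e \<Phi> p vs = (\<Sum>k = 1..CARD('n) - 1. pullback (h_map e k) (rho e \<Phi> k) p vs)"

end

theory Submission
  imports Defs "Jordan_Normal_Form.Determinant"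
begin

text \<open>Write \<open>W\<^sub>k = dx\<^sub>1 \<and> \<dots> \<and> dx\<^sub>k \<and> dX\<^sub>k\<^sub>+\<^sub>2 \<and> \<dots> \<and> dX\<^sub>n\<close> for \<open>0 \<le> k < n\<close>. In \<open>d (h\<^sub>k\<^sup>* \<rho>\<^sub>k)\<close> only the
  \<open>k\<close>-th and \<open>(k+1)\<close>-st partial derivatives of \<open>\<Phi>\<^sup>k\<close> survive, and they multiply \<open>W\<^sub>k\<close> and \<open>W\<^sub>k\<^sub>-\<^sub>1\<close>. After
  regrouping, \<open>\<Gamma>\<close> is a combination of the \<open>W\<^sub>k\<close> whose coefficients are, up to sign, the differences of
  the two sides of the \<open>n\<close> equations. The \<open>W\<^sub>k\<close> are linearly independent, so \<open>\<Gamma>\<close> vanishes exactly on the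
  solutions of the system. The system is triangular: the last equation determines \<open>X\<^sub>n\<close>, the one before
  it \<open>X\<^sub>n\<^sub>-\<^sub>1\<close>, and so on. In each step the unknown enters through a function of one variable whose
  derivative, by symmetry of the second derivatives, has absolute value at least \<open>\<ell>\<^sub>1\<close>; such a function is
  a bijection of the line, and the solution depends smoothly on the parameters.\<close>

no_notation vec_index (infixl "$" 100)
no_notation scalar_prod (infix "\<bullet>" 70)

subsection \<open>Calculus of smooth functions\<close>

text \<open>Since derivatives are unique, any explicit formula may replace
  \<open>frechet_derivative\<close>; the closure rules below take theirs from the usual
  differentiation rules.\<close>

lemma C_times_diff_SucI:
  assumes "\<And>x. (f has_derivative f' x) (at x)" and "\<And>v. C_times_diff k (\<lambda>x. f' x v)"
  shows "C_times_diff (Suc k) f"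
proof -
  have "frechet_derivative f (at x) = f' x" for x
    using assms(1) frechet_derivative_at by metis
  with assms show ?thesis by (auto simp: differentiable_def)
qed

lemma C_times_diff_has_derivative:
  "C_times_diff (Suc k) f \<Longrightarrow> (f has_derivative frechet_derivative f (at x)) (at x)"
  by (auto simp: frechet_derivative_works)

lemma C_times_diff_Suc_imp: "C_times_diff (Suc k) f \<Longrightarrow> C_times_diff k f"
proof (induction k arbitrary: f)
  case 0
  then show ?case
    by (simp add: continuous_at_imp_continuous_on differentiable_imp_continuous_within)
next
  case (Suc k)
  then show ?case unfolding C_times_diff.simps(2)[of "Suc k"] C_times_diff.simps(2)[of k f] by blast
qed

lemma C_times_diff_const: "C_times_diff k (\<lambda>x. c)"
  by (induction k arbitrary: c) auto

lemma C_times_diff_bounded_linear: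
  assumes "bounded_linear f"
  shows "C_times_diff k f"
proof (cases k)
  case 0
  then show ?thesis using assms by (simp add: linear_continuous_on)
next
  case (Suc m)
  show ?thesis unfolding Suc
    by (rule C_times_diff_SucI[where f' = "\<lambda>x. f"])
      (auto simp: bounded_linear_imp_has_derivative assms C_times_diff_const)
qed

lemma C_times_diff_bounded_linear_compose:
  assumes "bounded_linear f" and "C_times_diff k g"
  shows "C_times_diff k (\<lambda>x. f (g x))"
  using assms(2)
proof (induction k arbitrary: g)
  case 0
  then show ?case by (simp add: bounded_linear.continuous_on[OF assms(1)])
next
  case (Suc k)
  show ?case
    by (rule C_times_diff_SucI
        [OF bounded_linear.has_derivative[OF assms(1) C_times_diff_has_derivative[OF Suc.prems]]])
      (use Suc in auto)
qed

lemma C_times_diff_add: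
  assumes "C_times_diff k f" and "C_times_diff k g"
  shows "C_times_diff k (\<lambda>x. f x + g x)"
  using assms
proof (induction k arbitrary: f g)
  case 0
  then show ?case by (simp add: continuous_on_add)
next
  case (Suc k)
  show ?case
    by (rule C_times_diff_SucI[OF has_derivative_add
          [OF C_times_diff_has_derivative[OF Suc.prems(1)] C_times_diff_has_derivative[OF Suc.prems(2)]]])
      (use Suc in auto)
qed

lemma C_times_diff_sum:
  assumes "\<And>i. i \<in> I \<Longrightarrow> C_times_diff k (f i)"
  shows "C_times_diff k (\<lambda>x. \<Sum>i\<in>I. f i x)"
  using assms by (induction I rule: infinite_finite_induct)
    (auto intro: C_times_diff_const C_times_diff_add)

lemma C_times_diff_scaleR:
  assumes "C_times_diff k f" and "C_times_diff k g"
  shows "C_times_diff k (\<lambda>x. f x *\<^sub>R g x)"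
  using assms
proof (induction k arbitrary: f g)
  case 0
  then show ?case by (simp add: continuous_on_scaleR)
next
  case (Suc k)
  \<comment> \<open>The product rule leaves one factor undifferentiated, so both factors are needed
    one level lower as well.\<close>
  have "C_times_diff k f" "C_times_diff k g" using Suc.prems C_times_diff_Suc_imp by blast+
  then show ?case
    by (intro C_times_diff_SucI[OF has_derivative_scaleR
          [OF C_times_diff_has_derivative[OF Suc.prems(1)] C_times_diff_has_derivative[OF Suc.prems(2)]]]
        C_times_diff_add Suc.IH) (use Suc.prems in auto)
qed

lemma C_times_diff_mult:
  fixes f g :: "'a::real_normed_vector \<Rightarrow> real"
  shows "C_times_diff k f \<Longrightarrow> C_times_diff k g \<Longrightarrow> C_times_diff k (\<lambda>x. f x * g x)"
  using C_times_diff_scaleR[of k f g] by simp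

lemma C_times_diff_minus: "C_times_diff k f \<Longrightarrow> C_times_diff k (\<lambda>x. - f x)"
  by (rule C_times_diff_bounded_linear_compose) (simp_all add: bounded_linear_minus bounded_linear_ident)

lemma C_times_diff_diff:
  "C_times_diff k f \<Longrightarrow> C_times_diff k g \<Longrightarrow> C_times_diff k (\<lambda>x. f x - g x)"
  using C_times_diff_add[OF _ C_times_diff_minus, of k f g] by simp

lemma C_times_diff_inverse:
  fixes f :: "'a::real_normed_vector \<Rightarrow> real"
  assumes "C_times_diff k f" and "\<And>x. f x \<noteq> 0"
  shows "C_times_diff k (\<lambda>x. inverse (f x))"
  using assms(1)
proof (induction k)
  case 0
  then show ?case using assms(2) by (simp add: continuous_on_inverse)
next
  case (Suc k)
  \<comment> \<open>The derivative of \<open>inverse (f x)\<close> contains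
    \<open>inverse (f x)\<close> again, so the induction keeps \<open>f\<close> fixed.\<close>
  note IH = Suc.IH[OF C_times_diff_Suc_imp[OF Suc.prems]]
  show ?case
    by (rule C_times_diff_SucI[OF Deriv.has_derivative_inverse
          [OF assms(2) C_times_diff_has_derivative[OF Suc.prems]]])
      (use Suc.prems IH in \<open>auto intro!: C_times_diff_minus C_times_diff_mult\<close>)
qed

lemma C_times_diff_divide:
  fixes f g :: "'a::real_normed_vector \<Rightarrow> real"
  shows "C_times_diff k f \<Longrightarrow> C_times_diff k g \<Longrightarrow> (\<And>x. g x \<noteq> 0) \<Longrightarrow> C_times_diff k (\<lambda>x. f x / g x)"
  using C_times_diff_mult[OF _ C_times_diff_inverse, of k f g] by (simp add: divide_inverse)

lemma smooth_has_derivative: "smooth f \<Longrightarrow> (f has_derivative frechet_derivative f (at x)) (at x)"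
  using C_times_diff_has_derivative smooth_def by blast

lemma smooth_frechet_derivative: "smooth f \<Longrightarrow> smooth (\<lambda>x. frechet_derivative f (at x) v)"
  unfolding smooth_def using C_times_diff.simps(2) by blast

lemma smooth_continuous_on: "smooth f \<Longrightarrow> continuous_on S f"
  unfolding smooth_def by (metis C_times_diff.simps(1) continuous_on_subset top_greatest)

text \<open>In the chain rule the direction varies with the point, while \<open>C_times_diff\<close>
  fixes it. A basis expansion moves the varying direction into scalar coefficients.\<close>

lemma frechet_derivative_expand:
  fixes f :: "'a::euclidean_space \<Rightarrow> 'b::real_normed_vector"
  assumes "f differentiable (at x)"
  shows "frechet_derivative f (at x) v = (\<Sum>b\<in>Basis. (v \<bullet> b) *\<^sub>R frechet_derivative f (at x) b)"
proof -
  interpret linear "frechet_derivative f (at x)"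
    using assms by (rule linear_frechet_derivative)
  have "frechet_derivative f (at x) v = frechet_derivative f (at x) (\<Sum>b\<in>Basis. (v \<bullet> b) *\<^sub>R b)"
    by (simp add: euclidean_representation)
  also have "\<dots> = (\<Sum>b\<in>Basis. (v \<bullet> b) *\<^sub>R frechet_derivative f (at x) b)"
    by (simp add: sum scale)
  finally show ?thesis .
qed

text \<open>Only the inner function is limited to level \<open>k\<close>: directional derivatives of
  a smooth \<open>f\<close> are smooth again, so the induction runs over all such \<open>f\<close>.
  The bootstrap in \<open>smooth_inverse_function\<close> needs this asymmetry.\<close>

lemma C_times_diff_smooth_compose:
  fixes f :: "'a::euclidean_space \<Rightarrow> 'b::real_normed_vector"
  assumes "smooth f" and "C_times_diff k g"
  shows "C_times_diff k (\<lambda>x. f (g x))"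
  using assms
proof (induction k arbitrary: f g)
  case 0
  then show ?case
    using continuous_on_compose2[OF smooth_continuous_on[OF 0(1), of UNIV], of UNIV g] by simp
next
  case (Suc k)
  have g: "C_times_diff k g" using Suc.prems C_times_diff_Suc_imp by blast
  have d: "f differentiable (at x)" for x
    using smooth_has_derivative[OF Suc.prems(1)] by (auto simp: differentiable_def)
  have "((\<lambda>x. f (g x)) has_derivative
      (\<lambda>v. \<Sum>b\<in>Basis. (frechet_derivative g (at x) v \<bullet> b) *\<^sub>R frechet_derivative f (at (g x)) b)) (at x)" for x
    using has_derivative_compose[OF C_times_diff_has_derivative[OF Suc.prems(2)]
        smooth_has_derivative[OF Suc.prems(1)]]
    by (subst (asm) frechet_derivative_expand[OF d])
  then show ?case
  proof (rule C_times_diff_SucI)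
    fix v
    show "C_times_diff k (\<lambda>x. \<Sum>b\<in>Basis. (frechet_derivative g (at x) v \<bullet> b) *\<^sub>R frechet_derivative f (at (g x)) b)"
      by (intro C_times_diff_sum C_times_diff_scaleR Suc.IH[OF smooth_frechet_derivative]
          C_times_diff_bounded_linear_compose[OF bounded_linear_inner_left])
        (use Suc.prems g in auto)
  qed
qed

lemma smooth_const: "smooth (\<lambda>x. c)"
  by (simp add: smooth_def C_times_diff_const)

lemma smooth_bounded_linear: "bounded_linear f \<Longrightarrow> smooth f"
  by (simp add: smooth_def C_times_diff_bounded_linear)

lemma smooth_add: "smooth f \<Longrightarrow> smooth g \<Longrightarrow> smooth (\<lambda>x. f x + g x)"
  by (simp add: smooth_def C_times_diff_add)

lemma smooth_diff: "smooth f \<Longrightarrow> smooth g \<Longrightarrow> smooth (\<lambda>x. f x - g x)"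
  by (simp add: smooth_def C_times_diff_diff)

lemma smooth_scaleR: "smooth f \<Longrightarrow> smooth g \<Longrightarrow> smooth (\<lambda>x. f x *\<^sub>R g x)"
  by (simp add: smooth_def C_times_diff_scaleR)

lemma smooth_mult:
  fixes f g :: "'a::real_normed_vector \<Rightarrow> real"
  shows "smooth f \<Longrightarrow> smooth g \<Longrightarrow> smooth (\<lambda>x. f x * g x)"
  by (simp add: smooth_def C_times_diff_mult)

lemma smooth_sum: "(\<And>i. i \<in> I \<Longrightarrow> smooth (f i)) \<Longrightarrow> smooth (\<lambda>x. \<Sum>i\<in>I. f i x)"
  by (simp add: smooth_def C_times_diff_sum)

lemma smooth_compose:
  fixes f :: "'a::euclidean_space \<Rightarrow> 'b::real_normed_vector"
  shows "smooth f \<Longrightarrow> smooth g \<Longrightarrow> smooth (\<lambda>x. f (g x))"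
  by (simp add: smooth_def[of g] smooth_def[of "\<lambda>x. f (g x)"] C_times_diff_smooth_compose)

lemma C_times_diff_Pair:
  assumes "C_times_diff k f" "C_times_diff k g"
  shows "C_times_diff k (\<lambda>x. (f x, g x))"
proof -
  have "C_times_diff k (\<lambda>x. (f x, 0) + (0, g x))"
    by (intro C_times_diff_add C_times_diff_bounded_linear_compose[of "\<lambda>u. (u, 0)"]
        C_times_diff_bounded_linear_compose[of "\<lambda>u. (0, u)"] assms)
      (auto intro!: bounded_linear_intros)
  then show ?thesis by simp
qed

lemma smooth_Pair: "smooth f \<Longrightarrow> smooth g \<Longrightarrow> smooth (\<lambda>x. (f x, g x))"
  by (simp add: smooth_def C_times_diff_Pair)

subsection \<open>A global inverse function theorem in one variable with parameters\<close>

lemma MVT_real: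
  fixes u :: "real \<Rightarrow> real"
  assumes "\<And>t. (u has_real_derivative u' t) (at t)"
  obtains z where "min s t \<le> z" "z \<le> max s t" "u t - u s = (t - s) * u' z"
proof (cases s t rule: linorder_cases)
  case less
  then obtain z where "s < z" "z < t" "u t - u s = (t - s) * u' z"
    using MVT2[of s t u u'] assms by blast
  with that[of z] show thesis by simp
next
  case equal
  then show thesis using that[of s] by simp
next
  case greater
  then obtain z where z: "t < z" "z < s" "u s - u t = (s - t) * u' z"
    using MVT2[of t s u u'] assms by blast
  then have "u t - u s = (t - s) * u' z" by (simp add: algebra_simps)
  with that[of z] z show thesis by simp
qed

text \<open>A continuous derivative that avoids a neighbourhood of 0 has constant sign. Hence
  \<open>u\<close> or \<open>- u\<close> grows at least linearly, and the intermediate value theorem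
  applies.\<close>

lemma surj_if_derivative_bounded_below:
  fixes u :: "real \<Rightarrow> real"
  assumes d: "\<And>t. (u has_real_derivative u' t) (at t)" and c: "continuous_on UNIV u'"
    and l: "l > 0" "\<And>t. l \<le> \<bar>u' t\<bar>"
  shows "\<exists>t. u t = s"
proof -
  have pos: "\<exists>t. u t = s"
    if d: "\<And>t. (u has_real_derivative u' t) (at t)" and l': "\<And>t. l \<le> u' t" for u u' and s :: real
  proof -
    \<comment> \<open>With slope at least \<open>l\<close>, the distance \<open>T\<close> from 0
      suffices for \<open>u\<close> to pass \<open>s\<close>.\<close>
    define T where "T = (\<bar>s - u 0\<bar>) / l"
    have T: "T \<ge> 0" "l * T = \<bar>s - u 0\<bar>" using l(1) by (simp_all add: T_def)
    obtain z where "u T - u 0 = (T - 0) * u' z" using MVT_real[OF d] by blast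
    with mult_left_mono[OF l'[of z] T(1)] T(2) have 1: "s \<le> u T" by (simp add: algebra_simps abs_if split: if_splits)
    obtain z where "u 0 - u (-T) = (0 - (-T)) * u' z" using MVT_real[OF d] by blast
    with mult_left_mono[OF l'[of z] T(1)] T(2) have 2: "u (-T) \<le> s" by (simp add: algebra_simps abs_if split: if_splits)
    have "continuous_on {-T..T} u"
      using d DERIV_isCont continuous_at_imp_continuous_on by blast
    then show ?thesis using IVT'[of u "-T" s T] 1 2 T(1) by auto
  qed
  \<comment> \<open>The range of \<open>u'\<close> is an interval without 0, so the sign of
    \<open>u' 0\<close> is the sign everywhere.\<close>
  have conn: "connected (range u')" using c connected_continuous_image connected_UNIV by blast
  show ?thesis
  proof (cases "u' 0 > 0")
    case True
    have "l \<le> u' t" for t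
    proof (rule ccontr)
      assume "\<not> l \<le> u' t"
      then have "u' t \<le> 0" using l(2)[of t] l(1) by linarith
      then have "0 \<in> range u'"
        using connectedD_interval[OF conn, of "u' t" "u' 0" 0] True by auto
      then obtain r where "u' r = 0" by auto
      then show False using l(2)[of r] l(1) by simp
    qed
    then show ?thesis using pos d by blast
  next
    case False
    have "l \<le> - u' t" for t
    proof (rule ccontr)
      assume "\<not> l \<le> - u' t"
      then have "u' t \<ge> 0" using l(2)[of t] l(1) by linarith
      then have "0 \<in> range u'"
        using connectedD_interval[OF conn, of "u' 0" "u' t" 0] False by auto
      then obtain r where "u' r = 0" by auto
      then show False using l(2)[of r] l(1) by simp
    qed
    moreover have "((\<lambda>t. - u t) has_real_derivative - u' t) (at t)" for t
      using d by (rule DERIV_minus)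
    ultimately obtain t where "- u t = - s" using pos[of "\<lambda>t. - u t" "\<lambda>t. - u' t" "-s"] by blast
    then show ?thesis by auto
  qed
qed

lemma has_real_derivative_line:
  fixes f :: "'a::real_normed_vector \<Rightarrow> real"
  assumes "smooth f"
  shows "((\<lambda>t. f (x + t *\<^sub>R v)) has_real_derivative frechet_derivative f (at (x + t *\<^sub>R v)) v) (at t)"
proof -
  let ?D = "frechet_derivative f (at (x + t *\<^sub>R v))"
  have D: "(f has_derivative ?D) (at (x + t *\<^sub>R v))" by (rule smooth_has_derivative[OF assms])
  have "((\<lambda>t. x + t *\<^sub>R v) has_derivative (\<lambda>h. h *\<^sub>R v)) (at t)"
    by (auto intro!: derivative_eq_intros)
  from has_derivative_compose[OF this D]
  have "((\<lambda>t. f (x + t *\<^sub>R v)) has_derivative (\<lambda>h. ?D (h *\<^sub>R v))) (at t)" .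
  moreover have "?D (h *\<^sub>R v) = ?D v * h" for h
    using linear_cmul[OF has_derivative_linear[OF D]] by simp
  ultimately show ?thesis by (simp add: has_field_derivative_def)
qed

text \<open>For fixed \<open>a\<close> the map \<open>t \<mapsto> g (a, t)\<close> is a bijection of
  the line, and \<open>\<psi> (a, _)\<close> is its inverse. Regularity comes in three stages:
  continuity, an explicit derivative, and a bootstrap to all orders.\<close>

lemma smooth_inverse_function:
  fixes g :: "'a::euclidean_space \<times> real \<Rightarrow> real"
  assumes g: "smooth g" and l: "l > 0"
    and dg: "\<And>a t. l \<le> \<bar>frechet_derivative g (at (a, t)) (0, 1)\<bar>"
  obtains \<psi> where "smooth \<psi>" "\<And>a s t. g (a, t) = s \<longleftrightarrow> t = \<psi> (a, s)"
proof -
  define d where "d z = frechet_derivative g (at z) (0, 1)" for z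
  have der: "((\<lambda>t. g (a, t)) has_real_derivative d (a, t)) (at t)" for a t
    using has_real_derivative_line[OF g, of "(a, 0)" "(0, 1)" t] by (simp add: d_def)
  have ds: "smooth d" using smooth_frechet_derivative[OF g, of "(0, 1)"] by (simp add: d_def[abs_def])
  have dl: "l \<le> \<bar>d z\<bar>" for z using dg by (cases z) (simp add: d_def)
  have dn: "d z \<noteq> 0" for z using dl[of z] l by auto
  have ex: "\<exists>t. g (a, t) = s" for a s
  proof (rule surj_if_derivative_bounded_below[OF der _ l dl])
    show "continuous_on UNIV (\<lambda>t. d (a, t))"
      using continuous_on_compose2[OF smooth_continuous_on[OF ds, of UNIV], of UNIV "Pair a"]
      by (simp add: continuous_intros)
  qed
  \<comment> \<open>This estimate gives injectivity in \<open>t\<close> and later bounds differences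
    of \<open>\<psi>\<close>.\<close>
  have expand: "l * \<bar>t - s\<bar> \<le> \<bar>g (a, t) - g (a, s)\<bar>" for a s t
  proof -
    obtain z where "g (a, t) - g (a, s) = (t - s) * d (a, z)" using MVT_real[OF der] by blast
    then have "\<bar>g (a, t) - g (a, s)\<bar> = \<bar>d (a, z)\<bar> * \<bar>t - s\<bar>" by (simp add: abs_mult)
    then show ?thesis using mult_right_mono[OF dl[of "(a, z)"], of "\<bar>t - s\<bar>"] by simp
  qed
  have inj: "t = s" if "g (a, t) = g (a, s)" for a s t
    using expand[of t s a] that l by (simp add: mult_le_0_iff)
  define \<psi> where "\<psi> z = (SOME t. g (fst z, t) = snd z)" for z
  have \<psi>: "g (a, \<psi> (a, s)) = s" for a s
    unfolding \<psi>_def using someI_ex[OF ex[of a s]] by simp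
  have eq: "g (a, t) = s \<longleftrightarrow> t = \<psi> (a, s)" for a s t
    using inj[of a t "\<psi> (a, s)"] \<psi>[of a s] by metis
  \<comment> \<open>Both values are compared over the parameter \<open>fst w\<close>, where
    \<open>g (fst w, \<psi> w) = snd w\<close>. The resulting bound contains only the fixed number
    \<open>\<psi> z\<close>, is continuous in \<open>w\<close> and vanishes at
    \<open>w = z\<close>.\<close>
  have cont: "isCont \<psi> z" for z
  proof -
    have "isCont (\<lambda>w. (fst w, \<psi> z)) z" by (intro continuous_intros)
    moreover have "isCont g (fst z, \<psi> z)"
      using smooth_continuous_on[OF g, of UNIV] continuous_on_eq_continuous_at by blast
    ultimately have "isCont (\<lambda>w. g (fst w, \<psi> z)) z"
      using isCont_o2[of z "\<lambda>w. (fst w, \<psi> z)" g] by simp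
    then have "isCont (\<lambda>w. \<bar>snd w - g (fst w, \<psi> z)\<bar> / l) z"
      using l by (intro continuous_intros) auto
    then have "((\<lambda>w. \<bar>snd w - g (fst w, \<psi> z)\<bar> / l) \<longlongrightarrow> \<bar>snd z - g (fst z, \<psi> z)\<bar> / l) (at z)"
      by (simp add: isCont_def)
    moreover have "g (fst z, \<psi> z) = snd z" using \<psi>[of "fst z" "snd z"] by simp
    ultimately have lim: "((\<lambda>w. \<bar>snd w - g (fst w, \<psi> z)\<bar> / l) \<longlongrightarrow> 0) (at z)" by simp
    have "norm (\<psi> w - \<psi> z) \<le> \<bar>snd w - g (fst w, \<psi> z)\<bar> / l" for w
      using expand[of "\<psi> w" "\<psi> z" "fst w"] \<psi>[of "fst w" "snd w"] l
      by (simp add: field_simps)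
    then have "((\<lambda>w. \<psi> w - \<psi> z) \<longlongrightarrow> 0) (at z)"
      by (intro Lim_null_comparison[OF _ lim] always_eventually) auto
    then show ?thesis unfolding isCont_def by (rule LIM_zero_cancel)
  qed
  \<comment> \<open>\<open>G\<close> is the inverse of
    \<open>(a, t) \<mapsto> (a, g (a, t))\<close>, which turns the implicit function into an inverse
    map.\<close>
  define G where "G z = (fst z, \<psi> z)" for z :: "'a \<times> real"
  \<comment> \<open>Differentiating \<open>g (a, \<psi> (a, s)) = s\<close> and solving for the
    derivative of \<open>\<psi>\<close> yields this formula.\<close>
  define \<psi>' where "\<psi>' z v = (snd v - frechet_derivative g (at (G z)) (fst v, 0)) / d (G z)"
    for z v :: "'a \<times> real"
  have \<psi>': "(\<psi> has_derivative \<psi>' z) (at z)" for z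
  proof -
    let ?D = "frechet_derivative g (at (G z))"
    have D: "(g has_derivative ?D) (at (G z))" by (rule smooth_has_derivative[OF g])
    interpret D: bounded_linear ?D using D by (rule has_derivative_bounded_linear)
    have split: "?D v = ?D (fst v, 0) + snd v * d (G z)" for v
    proof -
      have "?D v = ?D ((fst v, 0) + snd v *\<^sub>R (0, 1))" by simp
      also have "\<dots> = ?D (fst v, 0) + snd v * d (G z)" by (simp only: D.add D.scaleR d_def) simp
      finally show ?thesis .
    qed
    have "(G has_derivative (\<lambda>v. (fst v, \<psi>' z v))) (at z)"
    proof (rule has_derivative_inverse_basic[where f = "\<lambda>w. (fst w, g w)" and T = UNIV])
      show "((\<lambda>w. (fst w, g w)) has_derivative (\<lambda>v. (fst v, ?D v))) (at (G z))"
        by (intro has_derivative_Pair has_derivative_fst has_derivative_ident D)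
      show "bounded_linear (\<lambda>v. (fst v, \<psi>' z v))"
      proof (intro bounded_linear_Pair bounded_linear_fst)
        have "bounded_linear (\<lambda>v. ?D (fst v, 0))"
          by (intro bounded_linear_compose[OF D.bounded_linear_axioms] bounded_linear_Pair
              bounded_linear_fst bounded_linear_zero)
        then show "bounded_linear (\<psi>' z)"
          unfolding \<psi>'_def[abs_def]
          by (intro bounded_linear_compose[OF bounded_linear_divide] bounded_linear_sub bounded_linear_snd)
      qed
      have "\<psi>' z (fst v, ?D v) = snd v" for v
        using dn[of "G z"] by (simp add: \<psi>'_def) (subst split, simp)
      then show "(\<lambda>v. (fst v, \<psi>' z v)) \<circ> (\<lambda>v. (fst v, ?D v)) = id"
        by (simp add: fun_eq_iff)
      show "isCont G z" unfolding G_def[abs_def] by (intro continuous_intros cont)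
      show "(fst (G w), g (G w)) = w" for w using \<psi>[of "fst w" "snd w"] by (simp add: G_def)
    qed auto
    from has_derivative_snd[OF this] show ?thesis by (simp add: G_def[abs_def])
  qed
  \<comment> \<open>Bootstrap: \<open>\<psi>' z v\<close> is a quotient of smooth functions of
    \<open>G z\<close>, so regularity of order \<open>k\<close> of \<open>\<psi>\<close> passes to
    its derivative.\<close>
  have "C_times_diff k \<psi>" for k
  proof (induction k)
    case 0
    then show ?case by (simp add: cont continuous_at_imp_continuous_on)
  next
    case (Suc k)
    have G: "C_times_diff k G"
      unfolding G_def[abs_def]
      by (intro C_times_diff_Pair Suc C_times_diff_bounded_linear bounded_linear_fst)
    show ?case
    proof (rule C_times_diff_SucI[OF \<psi>'])
      fix v
      show "C_times_diff k (\<lambda>z. \<psi>' z v)"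
        unfolding \<psi>'_def
        by (intro C_times_diff_divide C_times_diff_diff C_times_diff_const dn
            C_times_diff_smooth_compose[OF _ G] smooth_frechet_derivative[OF g] ds)
    qed
  qed
  then show thesis using that[of \<psi>] eq by (auto simp: smooth_def)
qed

subsection \<open>Symmetry of second derivatives\<close>

text \<open>The mean value theorem is used twice: along \<open>u\<close> for the difference of
  \<open>f\<close> on two parallel segments, then along \<open>v\<close> for the derivative in
  direction \<open>u\<close>.\<close>

lemma second_difference:
  fixes f :: "'a::real_normed_vector \<Rightarrow> real"
  assumes "smooth f" and "r > 0"
  obtains s t where "0 \<le> s" "s \<le> r" "0 \<le> t" "t \<le> r"
    "f (x + r *\<^sub>R u + r *\<^sub>R v) - f (x + r *\<^sub>R u) - f (x + r *\<^sub>R v) + f x =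
      r * r * frechet_derivative (\<lambda>y. frechet_derivative f (at y) u) (at (x + s *\<^sub>R u + t *\<^sub>R v)) v"
proof -
  let ?F = "\<lambda>y. frechet_derivative f (at y) u"
  have "((\<lambda>s. f (x + r *\<^sub>R v + s *\<^sub>R u) - f (x + s *\<^sub>R u)) has_real_derivative
      ?F (x + r *\<^sub>R v + s *\<^sub>R u) - ?F (x + s *\<^sub>R u)) (at s)" for s
    by (intro DERIV_diff has_real_derivative_line assms)
  from MVT_real[OF this, of 0 r] assms(2) obtain s where s: "0 \<le> s" "s \<le> r"
    "f (x + r *\<^sub>R v + r *\<^sub>R u) - f (x + r *\<^sub>R u) - (f (x + r *\<^sub>R v) - f x) =
      r * (?F (x + r *\<^sub>R v + s *\<^sub>R u) - ?F (x + s *\<^sub>R u))"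
    by auto
  from MVT_real[OF has_real_derivative_line[OF smooth_frechet_derivative[OF assms(1), of u],
      of "x + s *\<^sub>R u" v], of 0 r] assms(2)
  obtain t where t: "0 \<le> t" "t \<le> r"
    "?F (x + s *\<^sub>R u + r *\<^sub>R v) - ?F (x + s *\<^sub>R u) = r * frechet_derivative ?F (at (x + s *\<^sub>R u + t *\<^sub>R v)) v"
    by auto
  show thesis
    by (rule that[OF s(1,2) t(1,2)]) (use s(3) t(3) in \<open>simp add: algebra_simps\<close>)
qed

text \<open>The second difference is symmetric in \<open>u\<close> and \<open>v\<close>, and divided
  by the squared step it tends to the mixed derivative in either order.\<close>

lemma frechet_derivative_symmetric:
  fixes f :: "'a::real_normed_vector \<Rightarrow> real"
  assumes f: "smooth f"
  shows "frechet_derivative (\<lambda>y. frechet_derivative f (at y) u) (at x) v =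
         frechet_derivative (\<lambda>y. frechet_derivative f (at y) v) (at x) u"
proof -
  define r where "r n = 1 / real (Suc n)" for n
  have r: "r n > 0" "r \<longlonglongrightarrow> 0" for n
    using LIMSEQ_Suc[OF lim_1_over_n] by (simp_all add: r_def[abs_def])
  have main: "(\<lambda>n. (f (x + r n *\<^sub>R u + r n *\<^sub>R v) - f (x + r n *\<^sub>R u) - f (x + r n *\<^sub>R v) + f x)
      / (r n * r n)) \<longlonglongrightarrow> frechet_derivative (\<lambda>y. frechet_derivative f (at y) u) (at x) v" for u v
  proof -
    let ?H = "\<lambda>y. frechet_derivative (\<lambda>y. frechet_derivative f (at y) u) (at y) v"
    have "\<exists>s t. (0 \<le> s \<and> s \<le> r n) \<and> (0 \<le> t \<and> t \<le> r n) \<and>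
        (f (x + r n *\<^sub>R u + r n *\<^sub>R v) - f (x + r n *\<^sub>R u) - f (x + r n *\<^sub>R v) + f x) / (r n * r n) =
        ?H (x + s *\<^sub>R u + t *\<^sub>R v)" (is "\<exists>s t. ?P n s t") for n
    proof -
      obtain s t where "0 \<le> s" "s \<le> r n" "0 \<le> t" "t \<le> r n"
        "f (x + r n *\<^sub>R u + r n *\<^sub>R v) - f (x + r n *\<^sub>R u) - f (x + r n *\<^sub>R v) + f x =
          r n * r n * ?H (x + s *\<^sub>R u + t *\<^sub>R v)"
        using second_difference[OF f r(1)] .
      then have "?P n s t" using r(1)[of n] by simp
      then show ?thesis by blast
    qed
    then obtain s t where st: "\<And>n. 0 \<le> s n \<and> s n \<le> r n" "\<And>n. 0 \<le> t n \<and> t n \<le> r n"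
      and eq: "\<And>n. (f (x + r n *\<^sub>R u + r n *\<^sub>R v) - f (x + r n *\<^sub>R u) - f (x + r n *\<^sub>R v) + f x) / (r n * r n) =
        ?H (x + s n *\<^sub>R u + t n *\<^sub>R v)"
      by metis
    \<comment> \<open>The intermediate points are squeezed towards \<open>x\<close>, where the mixed
      derivative is continuous.\<close>
    have "s \<longlonglongrightarrow> 0" "t \<longlonglongrightarrow> 0"
      using st by (auto intro!: tendsto_sandwich[OF _ _ tendsto_const r(2)] always_eventually)
    then have "(\<lambda>n. x + s n *\<^sub>R u + t n *\<^sub>R v) \<longlonglongrightarrow> x + 0 *\<^sub>R u + 0 *\<^sub>R v"
      by (intro tendsto_intros)
    moreover have "isCont ?H x"
      using smooth_continuous_on[OF smooth_frechet_derivative[OF smooth_frechet_derivative[OF f]], of UNIV]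
        continuous_on_eq_continuous_at by blast
    ultimately show ?thesis unfolding eq by (intro isCont_tendsto_compose[of x ?H]) auto
  qed
  have "f (x + r n *\<^sub>R u + r n *\<^sub>R v) - f (x + r n *\<^sub>R u) - f (x + r n *\<^sub>R v) + f x =
        f (x + r n *\<^sub>R v + r n *\<^sub>R u) - f (x + r n *\<^sub>R v) - f (x + r n *\<^sub>R u) + f x" for n
  proof -
    have "x + r n *\<^sub>R u + r n *\<^sub>R v = x + r n *\<^sub>R v + r n *\<^sub>R u"
      by (simp only: add.assoc add.commute[of "r n *\<^sub>R u" "r n *\<^sub>R v"])
    then show ?thesis by (simp only:)
  qed
  from LIMSEQ_unique[OF main[of u v, unfolded this] main[of v u]] show ?thesis .
qed


subsection \<open>Wedge products as determinants\<close>

text \<open>The defining sum is the Leibniz formula, so Laplace expansion and the vanishing for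
  equal rows or columns carry over to wedges.\<close>

lemma wedge_eq_det:
  assumes "length vs = length \<theta>s"
  shows "wedge \<theta>s vs = Determinant.det
    (Matrix.mat (length \<theta>s) (length \<theta>s) (\<lambda>(i, j). (\<theta>s ! i) (vs ! j)))"
proof -
  have "(\<Prod>i<length \<theta>s. (\<theta>s ! i) (vs ! \<pi> i)) =
      (\<Prod>i = 0..<length \<theta>s. Matrix.mat (length \<theta>s) (length \<theta>s) (\<lambda>(i, j). (\<theta>s ! i) (vs ! j)) $$ (i, \<pi> i))"
    if "\<pi> permutes {..<length \<theta>s}" for \<pi>
    unfolding atLeast0LessThan
    using permutes_in_image[OF that] by (intro prod.cong) auto
  then show ?thesis
    by (simp add: wedge_def Determinant.det_def atLeast0LessThan)
qed

text \<open>Laplace expansion along the row of \<open>\<theta>\<close>. The alternating sum over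
  omitted vectors has the shape of \<open>ext_deriv\<close>, so an exterior derivative can be read
  as a wedge with \<open>\<theta>\<close> inserted.\<close>

lemma wedge_expand:
  assumes "length vs = Suc (length L1 + length L2)"
  shows "wedge (L1 @ \<theta> # L2) vs = (-1) ^ length L1 *
    (\<Sum>j<length vs. (-1) ^ j * (\<theta> (vs ! j) * wedge (L1 @ L2) (take j vs @ drop (Suc j) vs)))"
proof -
  let ?k = "length L1" and ?n = "Suc (length L1 + length L2)"
  let ?A = "Matrix.mat ?n ?n (\<lambda>(i, j). ((L1 @ \<theta> # L2) ! i) (vs ! j))"
  have "wedge (L1 @ \<theta> # L2) vs = Determinant.det ?A"
    using assms by (simp add: wedge_eq_det)
  also have "\<dots> = (\<Sum>j<?n. ?A $$ (?k, j) * cofactor ?A ?k j)"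
    by (rule laplace_expansion_row) auto
  also have "\<dots> = (\<Sum>j<?n. (-1) ^ ?k * ((-1) ^ j *
      (\<theta> (vs ! j) * wedge (L1 @ L2) (take j vs @ drop (Suc j) vs))))"
  proof (rule sum.cong[OF refl])
    fix j assume "j \<in> {..<?n}"
    then have j: "j < ?n" by simp
    have "mat_delete ?A ?k j = Matrix.mat (?n - 1) (?n - 1)
        (\<lambda>(a, b). ((L1 @ L2) ! a) ((take j vs @ drop (Suc j) vs) ! b))"
      by (rule eq_matI) (use j assms in \<open>auto simp: mat_delete_def nth_append Suc_diff_le min_def\<close>)
    then have "Determinant.det (mat_delete ?A ?k j) = wedge (L1 @ L2) (take j vs @ drop (Suc j) vs)"
      using j assms by (subst wedge_eq_det) (auto simp: min_def)
    then show "?A $$ (?k, j) * cofactor ?A ?k j = (-1) ^ ?k * ((-1) ^ j *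
        (\<theta> (vs ! j) * wedge (L1 @ L2) (take j vs @ drop (Suc j) vs)))"
      using j by (simp add: cofactor_def power_add nth_append)
  qed
  finally show ?thesis
    by (simp only: assms sum_distrib_left)
qed

lemma wedge_repeated_covector:
  assumes "length vs = length \<theta>s" "i < j" "j < length \<theta>s" "\<theta>s ! i = \<theta>s ! j"
  shows "wedge \<theta>s vs = 0"
  unfolding wedge_eq_det[OF assms(1)]
  by (rule det_identical_rows[where i = i and j = j]) (use assms in auto)

lemma wedge_repeated_vector:
  assumes "length vs = length \<theta>s" "i < j" "j < length \<theta>s" "vs ! i = vs ! j"
  shows "wedge \<theta>s vs = 0"
  unfolding wedge_eq_det[OF assms(1)]
  by (rule det_identical_columns[where i = i and j = j]) (use assms in auto)

lemma wedge_dual_basis: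
  assumes "length vs = length \<theta>s"
    and "\<And>i j. i < length \<theta>s \<Longrightarrow> j < length \<theta>s \<Longrightarrow> (\<theta>s ! i) (vs ! j) = (if i = j then 1 else 0)"
  shows "wedge \<theta>s vs = 1"
proof -
  have "Matrix.mat (length \<theta>s) (length \<theta>s) (\<lambda>(i, j). (\<theta>s ! i) (vs ! j)) = 1\<^sub>m (length \<theta>s)"
    by (rule eq_matI) (use assms(2) in auto)
  then show ?thesis by (simp add: wedge_eq_det[OF assms(1)])
qed

lemma wedge_zero_covector:
  assumes "length vs = length \<theta>s" and "\<theta> \<in> set \<theta>s" and "\<And>v. v \<in> set vs \<Longrightarrow> \<theta> v = 0"
  shows "wedge \<theta>s vs = 0"
  unfolding wedge_def
proof (intro sum.neutral ballI)
  fix \<pi> assume "\<pi> \<in> {\<pi>. \<pi> permutes {..<length \<theta>s}}"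
  then have p: "\<pi> permutes {..<length \<theta>s}" by simp
  obtain i where i: "i < length \<theta>s" "\<theta>s ! i = \<theta>" using assms(2) by (auto simp: in_set_conv_nth)
  then have "\<pi> i < length vs" using permutes_in_image[OF p, of i] assms(1) by simp
  then have "(\<theta>s ! i) (vs ! \<pi> i) = 0" using assms(3) i(2) by simp
  then have "(\<Prod>i<length \<theta>s. (\<theta>s ! i) (vs ! \<pi> i)) = 0" using i(1) by auto
  then show "of_int (sign \<pi>) * (\<Prod>i<length \<theta>s. (\<theta>s ! i) (vs ! \<pi> i)) = 0" by simp
qed

lemma linear_wedge_slot:
  assumes len: "length vs = length \<theta>s" and i: "i < length \<theta>s" and lin: "\<And>\<theta>. \<theta> \<in> set \<theta>s \<Longrightarrow> linear \<theta>"
  shows "linear (\<lambda>v. wedge \<theta>s (vs[i := v]))"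
proof -
  let ?n = "length \<theta>s"
  have summand: "linear (\<lambda>v. of_int (sign \<pi>) * (\<Prod>k<?n. (\<theta>s ! k) (vs[i := v] ! \<pi> k)))"
    if p: "\<pi> permutes {..<?n}" for \<pi>
  proof -
    \<comment> \<open>The varying vector enters the product for \<open>\<pi>\<close> only through
      the factor whose index \<open>\<pi>\<close> sends to \<open>i\<close>.\<close>
    obtain k where k: "k < ?n" "\<pi> k = i"
      using permutes_surj[OF p] permutes_in_image[OF p] i by (metis lessThan_iff surjD)
    have "(\<Prod>j<?n. (\<theta>s ! j) (vs[i := v] ! \<pi> j)) =
        (\<Prod>j\<in>{..<?n} - {k}. (\<theta>s ! j) (vs ! \<pi> j)) * (\<theta>s ! k) v" for v
    proof -
      have "(\<Prod>j<?n. (\<theta>s ! j) (vs[i := v] ! \<pi> j)) =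
          (\<theta>s ! k) (vs[i := v] ! \<pi> k) * (\<Prod>j\<in>{..<?n} - {k}. (\<theta>s ! j) (vs[i := v] ! \<pi> j))"
        using k by (intro prod.remove) auto
      also have "(\<Prod>j\<in>{..<?n} - {k}. (\<theta>s ! j) (vs[i := v] ! \<pi> j)) =
          (\<Prod>j\<in>{..<?n} - {k}. (\<theta>s ! j) (vs ! \<pi> j))"
      proof (rule prod.cong[OF refl])
        fix j assume "j \<in> {..<?n} - {k}"
        then have "\<pi> j \<noteq> i" using k(2) permutes_inj[OF p] by (auto dest: injD)
        then show "(\<theta>s ! j) (vs[i := v] ! \<pi> j) = (\<theta>s ! j) (vs ! \<pi> j)" by simp
      qed
      finally show ?thesis using k i len by simp
    qed
    moreover have "linear (\<theta>s ! k)" using lin k by simp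
    then have "linear (\<lambda>v. of_int (sign \<pi>) * ((\<Prod>j\<in>{..<?n} - {k}. (\<theta>s ! j) (vs ! \<pi> j)) * (\<theta>s ! k) v))"
      by (auto simp: linear_iff algebra_simps)
    ultimately show ?thesis by simp
  qed
  then show ?thesis unfolding wedge_def by (intro linear_compose_sum) auto
qed

lemma alternating_multilinear_wedge:
  assumes "\<And>\<theta>. \<theta> \<in> set \<theta>s \<Longrightarrow> linear \<theta>"
  shows "alternating_multilinear (length \<theta>s) (wedge \<theta>s)"
  unfolding alternating_multilinear_def
  using linear_wedge_slot[OF _ _ assms] wedge_repeated_vector by blast

lemma alternating_multilinear_scale:
  "alternating_multilinear k \<phi> \<Longrightarrow> alternating_multilinear k (\<lambda>vs. c * \<phi> vs)"
  unfolding alternating_multilinear_def by (auto simp: linear_iff algebra_simps)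

lemma alternating_multilinear_sum:
  "(\<And>i. i \<in> I \<Longrightarrow> alternating_multilinear k (\<phi> i)) \<Longrightarrow>
    alternating_multilinear k (\<lambda>vs. \<Sum>i\<in>I. \<phi> i vs)"
  unfolding alternating_multilinear_def by (auto intro!: linear_compose_sum sum.neutral)

lemma wedge_map:
  assumes "length vs = length \<theta>s"
  shows "wedge \<theta>s (map L vs) = wedge (map (\<lambda>\<theta> v. \<theta> (L v)) \<theta>s) vs"
proof -
  have "(\<Prod>i<length \<theta>s. (\<theta>s ! i) (map L vs ! \<pi> i)) =
      (\<Prod>i<length \<theta>s. (map (\<lambda>\<theta> v. \<theta> (L v)) \<theta>s ! i) (vs ! \<pi> i))"
    if "\<pi> permutes {..<length \<theta>s}" for \<pi>
    using permutes_in_image[OF that] assms by (intro prod.cong) auto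
  then show ?thesis by (simp add: wedge_def)
qed

text \<open>Formulas such as \<open>Lambda_eq\<close> hold only on lists of the right
  length.\<close>

lemma alternating_multilinear_cong:
  assumes "\<And>vs. length vs = k \<Longrightarrow> \<phi> vs = \<psi> vs" and "alternating_multilinear k \<psi>"
  shows "alternating_multilinear k \<phi>"
  using assms unfolding alternating_multilinear_def by simp

lemma wedge_repeated_in_middle:
  assumes "length vs = Suc (length L1 + length L2)" and "\<theta> \<in> set L1 \<union> set L2"
  shows "wedge (L1 @ \<theta> # L2) vs = 0"
proof (cases "\<theta> \<in> set L1")
  case True
  then obtain i where "i < length L1" "L1 ! i = \<theta>" by (auto simp: in_set_conv_nth)
  then show ?thesis
    using wedge_repeated_covector[of vs "L1 @ \<theta> # L2" i "length L1"] assms(1)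
    by (simp add: nth_append)
next
  case False
  then obtain i where "i < length L2" "L2 ! i = \<theta>" using assms(2) by (auto simp: in_set_conv_nth)
  then show ?thesis
    using wedge_repeated_covector[of vs "L1 @ \<theta> # L2" "length L1" "Suc (length L1 + i)"] assms(1)
    by (simp add: nth_append)
qed

subsection \<open>The form \<open>\<Gamma>\<close> and the system of equations\<close>

lemma part_deriv_eq_frechet_derivative:
  "smooth f \<Longrightarrow> part_deriv e i f m = frechet_derivative f (at m) (axis (e i) 1)"
  unfolding part_deriv_def using DERIV_imp_deriv has_real_derivative_line[of f m "axis (e i) 1" 0] by fastforce

lemma smooth_part_deriv: "smooth f \<Longrightarrow> smooth (part_deriv e i f)"
  using smooth_frechet_derivative[of f "axis (e i) 1"]
    ext[of "part_deriv e i f", OF part_deriv_eq_frechet_derivative] by metis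

lemma part_deriv_commute:
  assumes "smooth f"
  shows "part_deriv e i (part_deriv e j f) = part_deriv e j (part_deriv e i f)"
proof
  fix m
  have eq: "part_deriv e j f = (\<lambda>y. frechet_derivative f (at y) (axis (e j) 1))" for j
    using assms by (simp add: fun_eq_iff part_deriv_eq_frechet_derivative)
  have "part_deriv e i (part_deriv e j f) m =
      frechet_derivative (\<lambda>y. frechet_derivative f (at y) (axis (e j) 1)) (at m) (axis (e i) 1)" for i j
    unfolding eq[symmetric] by (rule part_deriv_eq_frechet_derivative[OF smooth_part_deriv[OF assms]])
  then show "part_deriv e i (part_deriv e j f) m = part_deriv e j (part_deriv e i f) m"
    using frechet_derivative_symmetric[OF assms] by simp
qed

lemma bounded_linear_h_map: "bounded_linear (h_map e k)"
  by (simp add: linear_conv_bounded_linear[symmetric] linear_iff h_map_def Finite_Cartesian_Product.vec_eq_iff)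

lemma pullback_bounded_linear:
  "bounded_linear h \<Longrightarrow> pullback h \<omega> p vs = \<omega> (h p) (map h vs)"
  by (simp add: pullback_def frechet_derivative_at[OF bounded_linear_imp_has_derivative, symmetric])

text \<open>\<open>W\<^sub>k\<close> is \<open>wedge (mixed_covectors e (k + 1) (k + 2))\<close>.\<close>

definition mixed_covectors :: "(nat \<Rightarrow> 'n::finite) \<Rightarrow> nat \<Rightarrow> nat \<Rightarrow> ((real ^ 'n) \<times> (real ^ 'n) \<Rightarrow> real) list" where
  "mixed_covectors e j k =
     map (\<lambda>i p. fst p $ e i) [1..<j] @ map (\<lambda>i p. snd p $ e i) [k..<CARD('n) + 1]"

text \<open>The tangent vectors dual to \<open>mixed_covectors e j k\<close>, used to read off
  single coefficients of \<Gamma>.\<close>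

definition mixed_basis :: "(nat \<Rightarrow> 'n::finite) \<Rightarrow> nat \<Rightarrow> nat \<Rightarrow> ((real ^ 'n) \<times> (real ^ 'n)) list" where
  "mixed_basis e j k =
     map (\<lambda>i. (axis (e i) 1, 0)) [1..<j] @ map (\<lambda>i. (0, axis (e i) 1)) [k..<CARD('n) + 1]"

lemma linear_mixed_covectors:
  assumes "\<theta> \<in> set (mixed_covectors e j k)"
  shows "linear \<theta>"
  using assms by (auto simp: mixed_covectors_def linear_iff)

lemma length_mixed_covectors: "length (mixed_covectors (e :: nat \<Rightarrow> 'n::finite) j k) = (j - 1) + (CARD('n) + 1 - k)"
  by (simp add: mixed_covectors_def del: upt_Suc)

lemma length_mixed_basis: "length (mixed_basis (e :: nat \<Rightarrow> 'n::finite) j k) = (j - 1) + (CARD('n) + 1 - k)"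
  by (simp add: mixed_basis_def del: upt_Suc)

text \<open>The equations are numbered so that \<open>k = 0\<close> is the one for \<open>X\<^sub>1\<close> and the \<open>k\<close>-th determines \<open>X\<^sub>k\<^sub>+\<^sub>1\<close>.\<close>

definition lhs_eq ::
    "(nat \<Rightarrow> 'n::finite) \<Rightarrow> (nat \<Rightarrow> real ^ 'n \<Rightarrow> real) \<Rightarrow> nat \<Rightarrow> (real ^ 'n) \<times> (real ^ 'n) \<Rightarrow> real" where
  "lhs_eq e \<Phi> k p = (if k = 0 then snd p $ e 1 else part_deriv e k (\<Phi> k) (h_map e k p))"

text \<open>The exceptional cases, \<open>lhs_eq\<close> at 0 and \<open>rhs_eq\<close> at
  \<open>CARD('n) - 1\<close>, are up to sign the coefficients of the two pulled back forms; the
  other cases come from the differential of \<open>Lambda\<close>.\<close>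

definition rhs_eq ::
    "(nat \<Rightarrow> 'n::finite) \<Rightarrow> (nat \<Rightarrow> real ^ 'n \<Rightarrow> real) \<Rightarrow> nat \<Rightarrow> (real ^ 'n) \<times> (real ^ 'n) \<Rightarrow> real" where
  "rhs_eq e \<Phi> k p =
     (if Suc k = CARD('n) then fst p $ e CARD('n)
      else part_deriv e (Suc (Suc k)) (\<Phi> (Suc k)) (h_map e (Suc k) p))"

text \<open>Each inner \<open>W k\<close> occurs in two neighbouring summands with opposite signs.
  The two end terms absent on the left are those supplied by the pullbacks in
  \<open>Gamma_form\<close>.\<close>

lemma telescoping_alternating_sum:
  fixes a b W :: "nat \<Rightarrow> real"
  shows "(\<Sum>k<m. (-1) ^ k * (a (Suc k) * W (Suc k) + b k * W k)) =
    a 0 * W 0 - (-1) ^ m * b m * W m - (\<Sum>k\<le>m. (-1) ^ k * (a k - b k) * W k)"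
proof (induction m)
  case 0
  show ?case by (simp add: left_diff_distrib)
next
  case (Suc m)
  \<comment> \<open>The induction step as a polynomial identity, with \<open>s\<close> for
    \<open>(-1) ^ m\<close> and \<open>T\<close> for the sum up to \<open>m\<close>.\<close>
  have "A - s * x * y - T + s * (z * w + x * y) = A - -1 * s * u * w - (T + -1 * s * (z - u) * w)"
    for A T s x y z w u :: real
    by (simp add: ring_distribs)
  then show ?case
    unfolding sum.lessThan_Suc sum.atMost_Suc Suc.IH power_Suc .
qed

section \<open>Numbered coordinates, independence of the mixed wedges, and pullbacks\<close>

context
  fixes e :: "nat \<Rightarrow> 'n::finite"
  assumes bij: "bij_betw e {1..CARD('n)} UNIV"
begin

lemma e_eq_iff: "i \<in> {1..CARD('n)} \<Longrightarrow> j \<in> {1..CARD('n)} \<Longrightarrow> e i = e j \<longleftrightarrow> i = j"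
  using inj_on_eq_iff[OF bij_betw_imp_inj_on[OF bij]] .

lemma vec_eq_iff_coordinates: "x = y \<longleftrightarrow> (\<forall>i\<in>{1..CARD('n)}. x $ e i = y $ e i)"
proof
  assume R: "\<forall>i\<in>{1..CARD('n)}. x $ e i = y $ e i"
  show "x = y"
  proof (rule Finite_Cartesian_Product.vec_eq_iff[THEN iffD2], rule allI)
    fix j
    have "j \<in> e ` {1..CARD('n)}" using bij by (simp add: bij_betw_def)
    then show "x $ j = y $ j" using R by auto
  qed
qed simp

lemma h_map_nth:
  assumes "i \<in> {1..CARD('n)}" "k \<le> CARD('n)"
  shows "h_map e k p $ e i = (if i \<le> k then fst p $ e i else snd p $ e i)"
proof -
  have "e i \<in> e ` {1..k} \<longleftrightarrow> i \<le> k"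
    using assms e_eq_iff by (auto simp: image_iff)
  then show ?thesis by (simp add: h_map_def)
qed

lemma frechet_derivative_coordinates:
  fixes f :: "real ^ 'n \<Rightarrow> real"
  assumes "smooth f"
  shows "frechet_derivative f (at m) u = (\<Sum>b = 1..CARD('n). u $ e b * part_deriv e b f m)"
proof -
  let ?D = "frechet_derivative f (at m)"
  have D: "linear ?D" using smooth_has_derivative[OF assms] by (rule has_derivative_linear)
  have "?D u = ?D (\<Sum>i\<in>UNIV. u $ i *\<^sub>R axis i 1)"
    by (simp add: basis_expansion[where 'a = real, unfolded scalar_mult_eq_scaleR])
  also have "\<dots> = (\<Sum>i\<in>UNIV. u $ i * ?D (axis i 1))"
    by (simp add: linear_sum[OF D] linear_cmul[OF D])
  also have "\<dots> = (\<Sum>b = 1..CARD('n). u $ e b * ?D (axis (e b) 1))"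
    by (rule sum.reindex_bij_betw[OF bij, symmetric])
  finally show ?thesis by (simp add: part_deriv_eq_frechet_derivative assms)
qed

text \<open>This gives the linear independence of the \<open>W\<^sub>k\<close>. If
  \<open>j < k\<close>, the covector \<open>dX\<^sub>k\<^sub>+\<^sub>1\<close> occurs in
  \<open>W\<^sub>j\<close> but kills the \<open>k\<close>-th basis list, which skips that direction;
  if \<open>j > k\<close>, the covector \<open>dx\<^sub>j\<close> does the same.\<close>

lemma wedge_mixed_dual:
  assumes "j < CARD('n)" "k < CARD('n)"
  shows "wedge (mixed_covectors e (j + 1) (j + 2)) (mixed_basis e (k + 1) (k + 2)) = (if j = k then 1 else 0)"
proof (cases "j = k")
  case True
  have "wedge (mixed_covectors e (k + 1) (k + 2)) (mixed_basis e (k + 1) (k + 2)) = 1"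
  proof (rule wedge_dual_basis)
    fix a b assume "a < length (mixed_covectors e (k + 1) (k + 2))"
      and "b < length (mixed_covectors e (k + 1) (k + 2))"
    then show "(mixed_covectors e (k + 1) (k + 2) ! a) (mixed_basis e (k + 1) (k + 2) ! b) = (if a = b then 1 else 0)"
      using assms(2)
      by (auto simp: mixed_covectors_def mixed_basis_def nth_append axis_def e_eq_iff simp del: upt_Suc)
  qed (use assms in \<open>simp add: length_mixed_covectors length_mixed_basis\<close>)
  then show ?thesis using True by simp
next
  case False
  have "wedge (mixed_covectors e (j + 1) (j + 2)) (mixed_basis e (k + 1) (k + 2)) = 0"
  proof (cases "j < k")
    case True
    show ?thesis
    proof (rule wedge_zero_covector[where \<theta> = "\<lambda>p. snd p $ e (k + 1)"])
      show "(\<lambda>p. snd p $ e (k + 1)) \<in> set (mixed_covectors e (j + 1) (j + 2))"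
        using True assms by (auto simp: mixed_covectors_def simp del: upt_Suc)
    next
      fix v assume "v \<in> set (mixed_basis e (k + 1) (k + 2))"
      then show "snd v $ e (k + 1) = 0"
        using assms by (auto simp: mixed_basis_def axis_def e_eq_iff simp del: upt_Suc)
    qed (use assms in \<open>simp add: length_mixed_covectors length_mixed_basis\<close>)
  next
    case False
    show ?thesis
    proof (rule wedge_zero_covector[where \<theta> = "\<lambda>p. fst p $ e j"])
      show "(\<lambda>p. fst p $ e j) \<in> set (mixed_covectors e (j + 1) (j + 2))"
        using False \<open>j \<noteq> k\<close> assms by (auto simp: mixed_covectors_def simp del: upt_Suc)
    next
      fix v assume "v \<in> set (mixed_basis e (k + 1) (k + 2))"
      then show "fst v $ e j = 0"
        using assms False \<open>j \<noteq> k\<close> by (auto simp: mixed_basis_def axis_def e_eq_iff simp del: upt_Suc)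
    qed (use assms in \<open>simp add: length_mixed_covectors length_mixed_basis\<close>)
  qed
  then show ?thesis using False by simp
qed

lemma dx_wedge_map:
  "length vs = length is \<Longrightarrow> dx_wedge e is (map L vs) = wedge (map (\<lambda>i v. L v $ e i) is) vs"
  by (simp add: dx_wedge_def wedge_map comp_def)

text \<open>The linear map \<open>h_map e k\<close> is its own derivative. It reads coordinates up
  to \<open>k\<close> from \<open>x\<close> and the later ones from \<open>X\<close>, so the two
  blocks of covectors become \<open>dx\<close> and \<open>dX\<close> respectively.\<close>

lemma pullback_rho:
  assumes k: "k \<in> {1..CARD('n) - 1}" and len: "length vs = CARD('n) - 2"
  shows "pullback (h_map e k) (rho e \<Phi> k) p vs =
    \<Phi> k (h_map e k p) * wedge (mixed_covectors e k (k + 2)) vs"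
proof -
  have "map (\<lambda>i v. h_map e k v $ e i) ([1..<k] @ [k + 2..<CARD('n) + 1]) = mixed_covectors e k (k + 2)"
    unfolding mixed_covectors_def map_append
    by (intro arg_cong2[where f = append] map_cong refl ext) (use k in \<open>auto simp: h_map_nth\<close>)
  moreover have "length vs = length ([1..<k] @ [k + 2..<CARD('n) + 1])" using k len by auto
  ultimately show ?thesis
    by (simp add: pullback_bounded_linear bounded_linear_h_map rho_def dx_wedge_map del: upt_Suc)
qed

lemma Lambda_eq:
  assumes "length vs = CARD('n) - 2"
  shows "Lambda e \<Phi> p vs =
    (\<Sum>k = 1..CARD('n) - 1. \<Phi> k (h_map e k p) * wedge (mixed_covectors e k (k + 2)) vs)"
  using assms by (simp add: Lambda_def pullback_rho)

text \<open>The wedge is \<open>W\<^sub>0\<close>: its \<open>dx\<close> block is empty.\<close>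

lemma pullback_alpha_tilde:
  assumes "length vs = CARD('n) - 1"
  shows "pullback snd (alpha_tilde e) p vs = snd p $ e 1 * wedge (mixed_covectors e 1 2) vs"
  using assms
  by (simp add: pullback_bounded_linear bounded_linear_snd alpha_tilde_def dx_wedge_map mixed_covectors_def
      del: upt_Suc)

text \<open>The wedge is \<open>W\<^sub>n\<^sub>-\<^sub>1\<close>: its \<open>dX\<close> block is
  empty.\<close>

lemma pullback_alpha:
  assumes "length vs = CARD('n) - 1"
  shows "pullback fst (alpha e) p vs = (-1) ^ (CARD('n) - 1) * fst p $ e CARD('n) *
    wedge (mixed_covectors e CARD('n) (CARD('n) + 1)) vs"
  using assms
  by (simp add: pullback_bounded_linear bounded_linear_fst alpha_def dx_wedge_map mixed_covectors_def
      del: upt_Suc)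

section \<open>The differential of \<open>Lambda\<close> and the coefficients of \<Gamma>\<close>

context
  fixes \<Phi> :: "nat \<Rightarrow> real ^ 'n \<Rightarrow> real"
  assumes smooth_\<Phi>: "\<And>k. k \<in> {1..CARD('n) - 1} \<Longrightarrow> smooth (\<Phi> k)"
begin

lemma diff_form_Lambda: "diff_form (CARD('n) - 2) (Lambda e \<Phi>)"
  unfolding diff_form_def
proof (intro conjI allI impI)
  fix p
  show "alternating_multilinear (CARD('n) - 2) (Lambda e \<Phi> p)"
  proof (rule alternating_multilinear_cong[OF Lambda_eq])
    show "alternating_multilinear (CARD('n) - 2)
      (\<lambda>vs. \<Sum>k = 1..CARD('n) - 1. \<Phi> k (h_map e k p) * wedge (mixed_covectors e k (k + 2)) vs)"
    proof (intro alternating_multilinear_sum alternating_multilinear_scale)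
      fix k assume "k \<in> {1..CARD('n) - 1}"
      then have "length (mixed_covectors e k (k + 2)) = CARD('n) - 2"
        by (auto simp: length_mixed_covectors)
      moreover have "alternating_multilinear (length (mixed_covectors e k (k + 2)))
          (wedge (mixed_covectors e k (k + 2)))"
        by (rule alternating_multilinear_wedge) (rule linear_mixed_covectors)
      ultimately show "alternating_multilinear (CARD('n) - 2) (wedge (mixed_covectors e k (k + 2)))"
        by simp
    qed
  qed
next
  fix vs :: "((real ^ 'n) \<times> (real ^ 'n)) list" assume "length vs = CARD('n) - 2"
  then show "smooth (\<lambda>p. Lambda e \<Phi> p vs)"
    by (simp add: Lambda_eq del: One_nat_def)
      (intro smooth_sum smooth_mult smooth_const smooth_compose[OF smooth_\<Phi>] smooth_bounded_linear
        bounded_linear_h_map)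
qed

text \<open>Of the terms \<open>\<partial>\<^sub>b\<Phi>\<^sup>k dz\<^sub>b \<and> dx\<^sub>1 \<and> \<dots> \<and> dx\<^sub>k\<^sub>-\<^sub>1 \<and> dX\<^sub>k\<^sub>+\<^sub>2 \<and> \<dots> \<and> dX\<^sub>n\<close> of \<open>d (h\<^sub>k\<^sup>* \<rho>\<^sub>k)\<close> only
  \<open>b = k\<close> and \<open>b = k + 1\<close> survive, as the other \<open>dz\<^sub>b\<close> occur twice.\<close>

lemma ext_deriv_Lambda:
  assumes len: "length vs = CARD('n) - 1"
  shows "ext_deriv (Lambda e \<Phi>) p vs = (\<Sum>k = 1..CARD('n) - 1. (-1) ^ (k - 1) *
     (part_deriv e k (\<Phi> k) (h_map e k p) * wedge (mixed_covectors e (k + 1) (k + 2)) vs +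
      part_deriv e (k + 1) (\<Phi> k) (h_map e k p) * wedge (mixed_covectors e k (k + 1)) vs))"
proof -
  let ?w = "\<lambda>k i. wedge (mixed_covectors e k (k + 2)) (take i vs @ drop (Suc i) vs)"
  let ?pd = "\<lambda>k b. part_deriv e b (\<Phi> k) (h_map e k p)"
  \<comment> \<open>The vectors are fixed, so the wedges are constants and only the
    \<open>\<Phi> k\<close> are differentiated.\<close>
  have deriv: "frechet_derivative (\<lambda>q. Lambda e \<Phi> q (take i vs @ drop (Suc i) vs)) (at p) v =
      (\<Sum>k = 1..CARD('n) - 1. \<Sum>b = 1..CARD('n). ?pd k b * (h_map e k v $ e b * ?w k i))"
    if i: "i < length vs" for i v
  proof -
    have len': "length (take i vs @ drop (Suc i) vs) = CARD('n) - 2" using i len by simp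
    have "((\<lambda>q. \<Sum>k = 1..CARD('n) - 1. \<Phi> k (h_map e k q) * ?w k i) has_derivative
        (\<lambda>v. \<Sum>k = 1..CARD('n) - 1. frechet_derivative (\<Phi> k) (at (h_map e k p)) (h_map e k v) * ?w k i)) (at p)"
      by (intro has_derivative_sum has_derivative_mult_left
          has_derivative_compose[OF bounded_linear_imp_has_derivative[OF bounded_linear_h_map]]
          smooth_has_derivative smooth_\<Phi>)
    then have "frechet_derivative (\<lambda>q. Lambda e \<Phi> q (take i vs @ drop (Suc i) vs)) (at p) v =
        (\<Sum>k = 1..CARD('n) - 1. frechet_derivative (\<Phi> k) (at (h_map e k p)) (h_map e k v) * ?w k i)"
      by (simp only: Lambda_eq[OF len'] frechet_derivative_at[symmetric])
    also have "\<dots> = (\<Sum>k = 1..CARD('n) - 1. \<Sum>b = 1..CARD('n). ?pd k b * (h_map e k v $ e b * ?w k i))"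
      by (intro sum.cong refl)
        (subst frechet_derivative_coordinates, simp_all add: smooth_\<Phi> sum_distrib_right sum_distrib_left mult_ac)
    finally show ?thesis .
  qed
  have "ext_deriv (Lambda e \<Phi>) p vs = (\<Sum>i<length vs. \<Sum>k = 1..CARD('n) - 1. \<Sum>b = 1..CARD('n).
      ?pd k b * ((-1) ^ i * (h_map e k (vs ! i) $ e b * ?w k i)))"
    unfolding ext_deriv_def
    by (intro sum.cong refl) (simp add: deriv sum_distrib_left mult_ac)
  \<comment> \<open>The sum over \<open>i\<close> is moved innermost, where it becomes a Laplace
    expansion.\<close>
  also have "\<dots> = (\<Sum>k = 1..CARD('n) - 1. \<Sum>i<length vs. \<Sum>b = 1..CARD('n).
      ?pd k b * ((-1) ^ i * (h_map e k (vs ! i) $ e b * ?w k i)))"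
    by (rule sum.swap)
  also have "\<dots> = (\<Sum>k = 1..CARD('n) - 1. \<Sum>b = 1..CARD('n).
      ?pd k b * (\<Sum>i<length vs. (-1) ^ i * (h_map e k (vs ! i) $ e b * ?w k i)))"
    unfolding sum_distrib_left by (intro sum.cong refl sum.swap)
  also have "\<dots> = (\<Sum>k = 1..CARD('n) - 1. (-1) ^ (k - 1) *
     (?pd k k * wedge (mixed_covectors e (k + 1) (k + 2)) vs +
      ?pd k (k + 1) * wedge (mixed_covectors e k (k + 1)) vs))"
  proof (rule sum.cong[OF refl])
    fix k assume k: "k \<in> {1..CARD('n) - 1}"
    \<comment> \<open>The new covector \<open>z b\<close> is inserted between the two blocks; moving
      it past \<open>L1\<close> produces the sign \<open>(-1) ^ (k - 1)\<close>.\<close>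
    define L1 where "L1 = map (\<lambda>i (p :: (real ^ 'n) \<times> (real ^ 'n)). fst p $ e i) [1..<k]"
    define L2 where "L2 = map (\<lambda>i (p :: (real ^ 'n) \<times> (real ^ 'n)). snd p $ e i) [k + 2..<CARD('n) + 1]"
    define z where "z b = (\<lambda>p. h_map e k p $ e b)" for b
    have L: "mixed_covectors e k (k + 2) = L1 @ L2" "length L1 = k - 1"
      by (simp_all add: mixed_covectors_def L1_def L2_def del: upt_Suc)
    have lv: "length vs = Suc (length L1 + length L2)"
      using k len by (auto simp: L1_def L2_def simp del: upt_Suc)
    have S: "(\<Sum>i<length vs. (-1) ^ i * (h_map e k (vs ! i) $ e b * ?w k i)) =
        (-1) ^ (k - 1) * wedge (L1 @ z b # L2) vs" for b
      unfolding wedge_expand[OF lv] L z_def by (simp add: power_mult_distrib[symmetric] flip: mult.assoc)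
    have zero: "wedge (L1 @ z b # L2) vs = 0" if "b \<in> {1..CARD('n)} - {k, k + 1}" for b
    proof (rule wedge_repeated_in_middle[OF lv])
      have "z b = (if b \<le> k then (\<lambda>p. fst p $ e b) else (\<lambda>p. snd p $ e b))"
        using that k by (auto simp: z_def h_map_nth fun_eq_iff)
      then show "z b \<in> set L1 \<union> set L2"
        using that by (auto simp: L1_def L2_def simp del: upt_Suc)
    qed
    have zk: "z k = (\<lambda>p. fst p $ e k)" "z (k + 1) = (\<lambda>p. snd p $ e (k + 1))"
      using k by (auto simp: z_def h_map_nth fun_eq_iff)
    \<comment> \<open>The gap between the blocks consists of \<open>k\<close> and
      \<open>k + 1\<close>: inserting \<open>dx\<^sub>k\<close> prolongs the first block, inserting
      \<open>dX\<^sub>k\<^sub>+\<^sub>1\<close> the second.\<close>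
    have "[1..<k + 1] = [1..<k] @ [k]" "[k + 1..<CARD('n) + 1] = (k + 1) # [k + 2..<CARD('n) + 1]"
      using k upt_Suc_append[of 1 k] upt_conv_Cons[of "k + 1" "CARD('n) + 1"] by auto
    then have W: "L1 @ z k # L2 = mixed_covectors e (k + 1) (k + 2)"
      "L1 @ z (k + 1) # L2 = mixed_covectors e k (k + 1)"
      unfolding zk by (simp_all add: mixed_covectors_def L1_def L2_def del: upt_Suc)
    have "(\<Sum>b = 1..CARD('n). ?pd k b * (\<Sum>i<length vs. (-1) ^ i * (h_map e k (vs ! i) $ e b * ?w k i))) =
        (\<Sum>b\<in>{k, k + 1}. ?pd k b * ((-1) ^ (k - 1) * wedge (L1 @ z b # L2) vs))"
      unfolding S by (intro sum.mono_neutral_right) (use k zero in auto)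
    then show "(\<Sum>b = 1..CARD('n). ?pd k b * (\<Sum>i<length vs. (-1) ^ i * (h_map e k (vs ! i) $ e b * ?w k i))) =
        (-1) ^ (k - 1) * (?pd k k * wedge (mixed_covectors e (k + 1) (k + 2)) vs +
          ?pd k (k + 1) * wedge (mixed_covectors e k (k + 1)) vs)"
      using W by (simp add: algebra_simps)
  qed
  finally show ?thesis .
qed

lemma Gamma_form_eq:
  assumes n2: "CARD('n) \<ge> 2" and len: "length vs = CARD('n) - 1"
  shows "Gamma_form (alpha e) (alpha_tilde e) (Lambda e \<Phi>) p vs =
    (\<Sum>k<CARD('n). (-1) ^ k * (lhs_eq e \<Phi> k p - rhs_eq e \<Phi> k p) *
      wedge (mixed_covectors e (k + 1) (k + 2)) vs)"
proof -
  define m where "m = CARD('n) - 1"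
  have n: "CARD('n) = Suc m" "m \<ge> 1" using n2 by (auto simp: m_def)
  define W where "W k = wedge (mixed_covectors e (k + 1) (k + 2)) vs" for k
  \<comment> \<open>After the shift from \<open>k\<close> to \<open>Suc k\<close>, one
    \<open>\<Phi> (Suc k)\<close> feeds the left side of equation \<open>Suc k\<close> and the right
    side of equation \<open>k\<close>.\<close>
  have "ext_deriv (Lambda e \<Phi>) p vs =
      (\<Sum>k<m. (-1) ^ k * (lhs_eq e \<Phi> (Suc k) p * W (Suc k) + rhs_eq e \<Phi> k p * W k))"
    unfolding ext_deriv_Lambda[OF len] m_def[symmetric] One_nat_def sum.atLeast1_atMost_eq
    by (intro sum.cong refl) (auto simp: lhs_eq_def rhs_eq_def W_def n(1))
  also have "\<dots> = lhs_eq e \<Phi> 0 p * W 0 - (-1) ^ m * rhs_eq e \<Phi> m p * W m -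
      (\<Sum>k\<le>m. (-1) ^ k * (lhs_eq e \<Phi> k p - rhs_eq e \<Phi> k p) * W k)"
    by (rule telescoping_alternating_sum)
  finally show ?thesis
    unfolding Gamma_form_def pullback_alpha_tilde[OF len] pullback_alpha[OF len]
    by (simp add: n lhs_eq_def[of e \<Phi> 0] rhs_eq_def[of e \<Phi> m] W_def lessThan_Suc_atMost numeral_2_eq_2)
qed

text \<open>Evaluating \<Gamma> on the \<open>j\<close>-th dual list isolates the coefficient of
  \<open>W\<^sub>j\<close>.\<close>

lemma vanishing_set_Gamma_form:
  assumes n2: "CARD('n) \<ge> 2"
  shows "p \<in> vanishing_set (CARD('n) - 1) (Gamma_form (alpha e) (alpha_tilde e) (Lambda e \<Phi>)) \<longleftrightarrow>
    (\<forall>k<CARD('n). lhs_eq e \<Phi> k p = rhs_eq e \<Phi> k p)"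
proof
  assume van: "p \<in> vanishing_set (CARD('n) - 1) (Gamma_form (alpha e) (alpha_tilde e) (Lambda e \<Phi>))"
  show "\<forall>k<CARD('n). lhs_eq e \<Phi> k p = rhs_eq e \<Phi> k p"
  proof (intro allI impI)
    fix j assume j: "j < CARD('n)"
    let ?vs = "mixed_basis e (j + 1) (j + 2)"
    have len: "length ?vs = CARD('n) - 1" using j by (simp add: length_mixed_basis)
    then have "0 = Gamma_form (alpha e) (alpha_tilde e) (Lambda e \<Phi>) p ?vs"
      using van by (simp add: vanishing_set_def)
    also have "\<dots> = (\<Sum>k<CARD('n). (-1) ^ k * (lhs_eq e \<Phi> k p - rhs_eq e \<Phi> k p) * (if k = j then 1 else 0))"
      unfolding Gamma_form_eq[OF n2 len] by (intro sum.cong refl) (use j wedge_mixed_dual in auto)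
    also have "\<dots> = (-1) ^ j * (lhs_eq e \<Phi> j p - rhs_eq e \<Phi> j p)"
      using j by (simp add: if_distrib cong: if_cong)
    finally show "lhs_eq e \<Phi> j p = rhs_eq e \<Phi> j p" by simp
  qed
qed (simp add: vanishing_set_def Gamma_form_eq[OF n2])

subsection \<open>Solving the triangular system\<close>

lemma smooth_rhs_eq:
  assumes "k < CARD('n)"
  shows "smooth (rhs_eq e \<Phi> k)"
proof (cases "Suc k = CARD('n)")
  case True
  have "rhs_eq e \<Phi> k = (\<lambda>p. fst p $ e CARD('n))" using True by (simp add: rhs_eq_def fun_eq_iff)
  then show ?thesis
    by (simp add: smooth_bounded_linear bounded_linear_compose[OF bounded_linear_vec_nth bounded_linear_fst])
next
  case False
  then have "smooth (part_deriv e (Suc (Suc k)) (\<Phi> (Suc k)))"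
    using assms by (intro smooth_part_deriv smooth_\<Phi>) auto
  from smooth_compose[OF this smooth_bounded_linear[OF bounded_linear_h_map]]
  have "smooth (\<lambda>p. part_deriv e (Suc (Suc k)) (\<Phi> (Suc k)) (h_map e (Suc k) p))" .
  moreover have "rhs_eq e \<Phi> k = (\<lambda>p. part_deriv e (Suc (Suc k)) (\<Phi> (Suc k)) (h_map e (Suc k) p))"
    using False by (simp add: rhs_eq_def fun_eq_iff)
  ultimately show ?thesis by simp
qed

text \<open>This is the triangular structure: \<open>h_map e (Suc k)\<close> takes its first
  \<open>k + 1\<close> coordinates from \<open>x\<close>, so only later coordinates of
  \<open>X\<close> matter.\<close>

lemma rhs_eq_cong:
  assumes "k < CARD('n)" "\<And>i. i \<in> {k + 2..CARD('n)} \<Longrightarrow> X $ e i = Y $ e i"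
  shows "rhs_eq e \<Phi> k (x, X) = rhs_eq e \<Phi> k (x, Y)"
proof -
  have "h_map e (Suc k) (x, X) = h_map e (Suc k) (x, Y)"
    unfolding vec_eq_iff_coordinates using assms by (auto simp: h_map_nth)
  then show ?thesis by (simp add: rhs_eq_def)
qed

text \<open>Once the later coordinates are given by \<open>F x\<close>, the right side depends on
  \<open>x\<close> alone and the left side on \<open>x\<close> and one unknown, with derivative
  bounded away from 0. The smooth inverse then solves for that unknown.\<close>

lemma solve_for_one_coordinate:
  assumes l: "l > 0"
    and bound: "\<And>k m. k \<in> {1..CARD('n) - 1} \<Longrightarrow> l \<le> \<bar>part_deriv e k (part_deriv e (k + 1) (\<Phi> k)) m\<bar>"
    and k: "k < CARD('n)" and F: "smooth F"
  obtains \<phi> where "smooth \<phi>"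
    "\<And>x X. (\<And>i. i \<in> {k + 2..CARD('n)} \<Longrightarrow> X $ e i = F x $ e i) \<Longrightarrow>
      lhs_eq e \<Phi> k (x, X) = rhs_eq e \<Phi> k (x, X) \<longleftrightarrow> X $ e (k + 1) = \<phi> x"
proof -
  define c where "c x = rhs_eq e \<Phi> k (x, F x)" for x
  have c: "smooth c"
    unfolding c_def[abs_def]
    by (intro smooth_compose[OF smooth_rhs_eq] smooth_Pair F k smooth_bounded_linear bounded_linear_ident)
  have rhs: "rhs_eq e \<Phi> k (x, X) = c x"
    if "\<And>i. i \<in> {k + 2..CARD('n)} \<Longrightarrow> X $ e i = F x $ e i" for x X
    unfolding c_def using that k by (intro rhs_eq_cong) auto
  show thesis
  proof (cases "k = 0")
    \<comment> \<open>The equation for \<open>k = 0\<close> is already solved for the first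
      coordinate of \<open>X\<close>.\<close>
    case True
    show thesis
      by (rule that[OF c]) (use rhs True in \<open>simp add: lhs_eq_def\<close>)
  next
    case False
    then have k': "k \<in> {1..CARD('n) - 1}" using k by auto
    define a where "a = (axis (e (k + 1)) 1 :: real ^ 'n)"
    \<comment> \<open>The argument of \<open>\<Phi> k\<close> with slot \<open>k + 1\<close> set to
      0: \<open>x\<close> before that slot, \<open>F x\<close> after it. Adding
      \<open>t *\<^sub>R a\<close> then puts the unknown there.\<close>
    define base where "base x = h_map e (k + 1) (x, F x) - (x $ e (k + 1)) *\<^sub>R a" for x
    define P where "P = part_deriv e k (\<Phi> k)"
    define g where "g z = P (base (fst z) + snd z *\<^sub>R a)" for z
    have smooth_base: "smooth base"
      unfolding base_def[abs_def]
      by (intro smooth_diff smooth_scaleR smooth_const smooth_compose[OF smooth_bounded_linear[OF bounded_linear_h_map]]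
          smooth_Pair F smooth_bounded_linear bounded_linear_ident bounded_linear_vec_nth)
    have P: "smooth P" unfolding P_def by (intro smooth_part_deriv smooth_\<Phi> k')
    have g: "smooth g"
      unfolding g_def[abs_def]
      by (intro smooth_compose[OF P] smooth_add smooth_scaleR smooth_const smooth_compose[OF smooth_base]
          smooth_bounded_linear bounded_linear_fst bounded_linear_snd)
    have dg: "l \<le> \<bar>frechet_derivative g (at (x, t)) (0, 1)\<bar>" for x t
    proof -
      have "((\<lambda>t. g ((x, 0) + t *\<^sub>R (0, 1))) has_real_derivative
          frechet_derivative g (at ((x, 0) + t *\<^sub>R (0, 1))) (0, 1)) (at t)"
        by (rule has_real_derivative_line[OF g])
      then have "((\<lambda>t. P (base x + t *\<^sub>R a)) has_real_derivative
          frechet_derivative g (at (x, t)) (0, 1)) (at t)"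
        by (simp add: g_def)
      from DERIV_unique[OF this has_real_derivative_line[OF P]]
      have "frechet_derivative g (at (x, t)) (0, 1) = part_deriv e (k + 1) P (base x + t *\<^sub>R a)"
        by (simp add: part_deriv_eq_frechet_derivative[OF P] a_def)
      \<comment> \<open>The unknown sits in slot \<open>k + 1\<close> of the \<open>k\<close>-th
        partial derivative, so the order must be exchanged to meet the assumed bound.\<close>
      also have "\<dots> = part_deriv e k (part_deriv e (k + 1) (\<Phi> k)) (base x + t *\<^sub>R a)"
        unfolding P_def by (simp only: part_deriv_commute[OF smooth_\<Phi>[OF k'], of e k])
      finally show ?thesis using bound[OF k'] by simp
    qed
    obtain \<psi> where \<psi>: "smooth \<psi>" "\<And>x s t. g (x, t) = s \<longleftrightarrow> t = \<psi> (x, s)"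
      using smooth_inverse_function[OF g l dg] by blast
    show thesis
    proof (rule that[of "\<lambda>x. \<psi> (x, c x)"])
      show "smooth (\<lambda>x. \<psi> (x, c x))"
        by (intro smooth_compose[OF \<psi>(1)] smooth_Pair c smooth_bounded_linear bounded_linear_ident)
    next
      fix x X assume X: "\<And>i. i \<in> {k + 2..CARD('n)} \<Longrightarrow> X $ e i = F x $ e i"
      have "h_map e k (x, X) $ e i = (base x + X $ e (k + 1) *\<^sub>R a) $ e i" if i: "i \<in> {1..CARD('n)}" for i
      proof -
        have a: "a $ e i = (if i = k + 1 then 1 else 0)"
          using e_eq_iff[OF i, of "k + 1"] k by (auto simp: a_def axis_def)
        show ?thesis
          unfolding base_def vector_add_component vector_minus_component vector_scaleR_component a
          using i k X[of i] by (auto simp: h_map_nth)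
      qed
      then have "h_map e k (x, X) = base x + X $ e (k + 1) *\<^sub>R a"
        unfolding vec_eq_iff_coordinates by blast
      then have "lhs_eq e \<Phi> k (x, X) = g (x, X $ e (k + 1))"
        using False by (simp add: lhs_eq_def g_def P_def)
      then show "lhs_eq e \<Phi> k (x, X) = rhs_eq e \<Phi> k (x, X) \<longleftrightarrow> X $ e (k + 1) = \<psi> (x, c x)"
        using rhs[OF X] \<psi>(2) by simp
    qed
  qed
qed

text \<open>Back substitution, by induction on the number \<open>d\<close> of equations solved from
  the end. Only the last \<open>d\<close> coordinates of \<open>F\<close> are constrained.\<close>

lemma solve_for_last_coordinates:
  assumes l: "l > 0"
    and bound: "\<And>k m. k \<in> {1..CARD('n) - 1} \<Longrightarrow> l \<le> \<bar>part_deriv e k (part_deriv e (k + 1) (\<Phi> k)) m\<bar>"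
    and "d \<le> CARD('n)"
  shows "\<exists>F. smooth F \<and> (\<forall>x X.
    (\<forall>k\<in>{CARD('n) - d..<CARD('n)}. lhs_eq e \<Phi> k (x, X) = rhs_eq e \<Phi> k (x, X)) \<longleftrightarrow>
    (\<forall>i\<in>{CARD('n) - d + 1..CARD('n)}. X $ e i = F x $ e i))"
  using \<open>d \<le> CARD('n)\<close>
proof (induction d)
  case 0
  \<comment> \<open>With \<open>d = 0\<close> both index ranges are empty, so the identity serves as
    a placeholder.\<close>
  show ?case by (rule exI[of _ "\<lambda>x. x"]) (simp add: smooth_bounded_linear)
next
  case (Suc d)
  define k where "k = CARD('n) - Suc d"
  have k: "k < CARD('n)" "CARD('n) - d = k + 1" using Suc.prems by (auto simp: k_def)
  obtain F where F: "smooth F" and eqs: "\<And>x X.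
    (\<forall>k\<in>{k + 1..<CARD('n)}. lhs_eq e \<Phi> k (x, X) = rhs_eq e \<Phi> k (x, X)) \<longleftrightarrow>
    (\<forall>i\<in>{k + 2..CARD('n)}. X $ e i = F x $ e i)"
    using Suc.IH Suc.prems by (auto simp: k(2))
  obtain \<phi> where \<phi>: "smooth \<phi>"
    "\<And>x X. (\<And>i. i \<in> {k + 2..CARD('n)} \<Longrightarrow> X $ e i = F x $ e i) \<Longrightarrow>
      lhs_eq e \<Phi> k (x, X) = rhs_eq e \<Phi> k (x, X) \<longleftrightarrow> X $ e (k + 1) = \<phi> x"
    using solve_for_one_coordinate[OF l bound k(1) F] by blast
  \<comment> \<open>Overwrites coordinate \<open>k + 1\<close> of \<open>F x\<close> by the new
    solution and keeps the others.\<close>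
  define F' where "F' x = F x + (\<phi> x - F x $ e (k + 1)) *\<^sub>R axis (e (k + 1)) 1" for x
  have smooth_F': "smooth F'"
    unfolding F'_def[abs_def]
    by (intro smooth_add smooth_scaleR smooth_diff smooth_const F \<phi>(1)
        smooth_compose[OF smooth_bounded_linear[OF bounded_linear_vec_nth]])
  have F': "F' x $ e i = (if i = k + 1 then \<phi> x else F x $ e i)" if "i \<in> {1..CARD('n)}" for x i
    using e_eq_iff[OF that, of "k + 1"] k(1) by (auto simp: F'_def axis_def)
  have ivl: "{k..<CARD('n)} = insert k {k + 1..<CARD('n)}" "{k + 1..CARD('n)} = insert (k + 1) {k + 2..CARD('n)}"
    using k(1) by auto
  have "(\<forall>k\<in>{k..<CARD('n)}. lhs_eq e \<Phi> k (x, X) = rhs_eq e \<Phi> k (x, X)) \<longleftrightarrow>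
      (\<forall>i\<in>{k + 1..CARD('n)}. X $ e i = F' x $ e i)" for x X
  proof -
    have "(\<forall>k\<in>{k..<CARD('n)}. lhs_eq e \<Phi> k (x, X) = rhs_eq e \<Phi> k (x, X)) \<longleftrightarrow>
        lhs_eq e \<Phi> k (x, X) = rhs_eq e \<Phi> k (x, X) \<and> (\<forall>i\<in>{k + 2..CARD('n)}. X $ e i = F x $ e i)"
      unfolding ivl(1) ball_simps eqs ..
    also have "\<dots> \<longleftrightarrow> X $ e (k + 1) = \<phi> x \<and> (\<forall>i\<in>{k + 2..CARD('n)}. X $ e i = F x $ e i)"
      using \<phi>(2) by blast
    also have "\<dots> \<longleftrightarrow> (\<forall>i\<in>{k + 1..CARD('n)}. X $ e i = F' x $ e i)"
      unfolding ivl(2) ball_simps using k(1) by (auto simp: F')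
    finally show ?thesis .
  qed
  then show ?case using smooth_F' unfolding k_def by blast
qed

end

end

section \<open>The generated map and its defining equations\<close>

theorem theorem7:
  fixes n :: nat
    and e :: "nat \<Rightarrow> 'n::finite"
    and \<Phi> :: "nat \<Rightarrow> real ^ 'n \<Rightarrow> real"
    and l1 l2 :: real
  assumes "n = CARD('n)" and "n \<ge> 2"
    and "bij_betw e {1..n} UNIV"
    and "\<And>k. k \<in> {1..n - 1} \<Longrightarrow> smooth (\<Phi> k)"
    and "l1 > 0" and "l2 > 0"
    and "\<And>k m. k \<in> {1..n - 1} \<Longrightarrow>
           l1 \<le> \<bar>part_deriv e k (part_deriv e (k + 1) (\<Phi> k)) m\<bar> \<and>
           \<bar>part_deriv e k (part_deriv e (k + 1) (\<Phi> k)) m\<bar> \<le> l2"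
  shows "generating_form (alpha e) (alpha_tilde e) (Lambda e \<Phi>) \<and>
    (\<forall>f. generates (alpha e) (alpha_tilde e) (Lambda e \<Phi>) f \<longrightarrow>
      (\<forall>x X. X = f x \<longleftrightarrow>
         X $ e 1 = part_deriv e 2 (\<Phi> 1) (h_map e 1 (x, X)) \<and>
         (\<forall>k \<in> {1..n - 2}.
            part_deriv e k (\<Phi> k) (h_map e k (x, X)) =
            part_deriv e (k + 2) (\<Phi> (k + 1)) (h_map e (k + 1) (x, X))) \<and>
         part_deriv e (n - 1) (\<Phi> (n - 1)) (h_map e (n - 1) (x, X)) = x $ e n))"
proof (intro conjI)
  have n: "CARD('n) = n" and bij: "bij_betw e {1..CARD('n)} UNIV"
    and smooth: "\<And>k. k \<in> {1..CARD('n) - 1} \<Longrightarrow> smooth (\<Phi> k)"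
    and bound: "\<And>k m. k \<in> {1..CARD('n) - 1} \<Longrightarrow>
      l1 \<le> \<bar>part_deriv e k (part_deriv e (k + 1) (\<Phi> k)) m\<bar>"
    and n2: "CARD('n) \<ge> 2"
    using assms by auto
  let ?V = "vanishing_set (DIM(real ^ 'n) - 1) (Gamma_form (alpha e) (alpha_tilde e) (Lambda e \<Phi>))"
  have V: "p \<in> ?V \<longleftrightarrow> (\<forall>k<n. lhs_eq e \<Phi> k p = rhs_eq e \<Phi> k p)" for p
    using vanishing_set_Gamma_form[OF bij smooth n2] by (simp add: n)
  \<comment> \<open>Back substitution with \<open>d = n\<close> covers all equations and all
    coordinates.\<close>
  obtain F where F: "smooth F" and eqs: "\<And>x X.
    (\<forall>k\<in>{0..<n}. lhs_eq e \<Phi> k (x, X) = rhs_eq e \<Phi> k (x, X)) \<longleftrightarrow> (\<forall>i\<in>{1..n}. X $ e i = F x $ e i)"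
    using solve_for_last_coordinates[OF bij smooth assms(5) bound order_refl] by (auto simp: n)
  have "(x, X) \<in> ?V \<longleftrightarrow> X = F x" for x X
    unfolding V using eqs[of x X] vec_eq_iff_coordinates[OF bij, of X "F x"]
    by (simp add: n atLeast0LessThan Ball_def)
  then have "generates (alpha e) (alpha_tilde e) (Lambda e \<Phi>) F"
    using F by (auto simp: generates_def)
  then show "generating_form (alpha e) (alpha_tilde e) (Lambda e \<Phi>)"
    using diff_form_Lambda[OF bij smooth] by (auto simp: generating_form_def)
  show "\<forall>f. generates (alpha e) (alpha_tilde e) (Lambda e \<Phi>) f \<longrightarrow>
      (\<forall>x X. X = f x \<longleftrightarrow>
         X $ e 1 = part_deriv e 2 (\<Phi> 1) (h_map e 1 (x, X)) \<and>
         (\<forall>k \<in> {1..n - 2}.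
            part_deriv e k (\<Phi> k) (h_map e k (x, X)) =
            part_deriv e (k + 2) (\<Phi> (k + 1)) (h_map e (k + 1) (x, X))) \<and>
         part_deriv e (n - 1) (\<Phi> (n - 1)) (h_map e (n - 1) (x, X)) = x $ e n)"
  proof (intro allI impI)
    fix f x X
    assume "generates (alpha e) (alpha_tilde e) (Lambda e \<Phi>) f"
    \<comment> \<open>Any generated map has the vanishing set as its graph, so the equations are
      derived for every such \<open>f\<close> at once.\<close>
    then have "X = f x \<longleftrightarrow> (x, X) \<in> ?V" by (auto simp: generates_def)
    also have "\<dots> \<longleftrightarrow> (\<forall>k\<in>insert 0 (insert (n - 1) {1..n - 2}). lhs_eq e \<Phi> k (x, X) = rhs_eq e \<Phi> k (x, X))"
    proof -
      \<comment> \<open>First, last and middle indices match the three groups of equations; for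
        \<open>n = 2\<close> the middle range is empty.\<close>
      have "{..<n} = insert 0 (insert (n - 1) {1..n - 2})" using assms(2) by auto
      then show ?thesis unfolding V by (metis lessThan_iff)
    qed
    also have "\<dots> \<longleftrightarrow> X $ e 1 = part_deriv e 2 (\<Phi> 1) (h_map e 1 (x, X)) \<and>
         (\<forall>k \<in> {1..n - 2}.
            part_deriv e k (\<Phi> k) (h_map e k (x, X)) =
            part_deriv e (k + 2) (\<Phi> (k + 1)) (h_map e (k + 1) (x, X))) \<and>
         part_deriv e (n - 1) (\<Phi> (n - 1)) (h_map e (n - 1) (x, X)) = x $ e n"
    proof -
      have "lhs_eq e \<Phi> 0 (x, X) = rhs_eq e \<Phi> 0 (x, X) \<longleftrightarrow>
          X $ e 1 = part_deriv e 2 (\<Phi> 1) (h_map e 1 (x, X))"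
        using assms(2) by (simp add: lhs_eq_def rhs_eq_def n numeral_2_eq_2)
      moreover have "lhs_eq e \<Phi> (n - 1) (x, X) = rhs_eq e \<Phi> (n - 1) (x, X) \<longleftrightarrow>
          part_deriv e (n - 1) (\<Phi> (n - 1)) (h_map e (n - 1) (x, X)) = x $ e n"
        using assms(2) by (simp add: lhs_eq_def rhs_eq_def n)
      moreover have "lhs_eq e \<Phi> k (x, X) = rhs_eq e \<Phi> k (x, X) \<longleftrightarrow>
          part_deriv e k (\<Phi> k) (h_map e k (x, X)) =
          part_deriv e (k + 2) (\<Phi> (k + 1)) (h_map e (k + 1) (x, X))" if "k \<in> {1..n - 2}" for k
        using that by (auto simp: lhs_eq_def rhs_eq_def n)
      ultimately show ?thesis unfolding ball_simps by blast
    qed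
    finally show "X = f x \<longleftrightarrow>
         X $ e 1 = part_deriv e 2 (\<Phi> 1) (h_map e 1 (x, X)) \<and>
         (\<forall>k \<in> {1..n - 2}.
            part_deriv e k (\<Phi> k) (h_map e k (x, X)) =
            part_deriv e (k + 2) (\<Phi> (k + 1)) (h_map e (k + 1) (x, X))) \<and>
         part_deriv e (n - 1) (\<Phi> (n - 1)) (h_map e (n - 1) (x, X)) = x $ e n" .
  qed
qed

end
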